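(* Let $\pi_0$ be a product prior on $\mathcal X_\xi=[-1,1]^{\mathbb N}$, let $\mathcal Q(\xi)=q_\xi$, and let $\mu_0=\mathcal Q_\#\pi_0$ be the induced prior on the reaction fields $q_\xi=q_{\max}f_\xi$. Use the Poisson-killing construction to generate the forward coins in the Bernstein--Poisson likelihood factory at every sensor $s_1,\dots,s_J$; that is, generate a master Poisson point process of candidates with intensity $\gamma e^{B_{\boldsymbol n}(y)}\mu_0$ and retain a candidate exactly when all $J$ of its component likelihood coins succeed. Then the retained process $\eta_\gamma$ is a Poisson point process with intensity $\gamma\nu^y$, where $\nu^y(\mathrm dq)=L(q;y)\,\mu_0(\mathrm dq)$. Conditional on its cardinality, the retained fields are independent draws from the continuum Bayesian posterior $\mu^y(\mathrm dq)=L(q;y)\,\mu_0(\mathrm dq)/Z(y)$, $Z(y)=\int L(q;y)\,\mu_0(\mathrm dq)$. No deterministic spatial discretization or fixed parameter truncation enters the mathematical target.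
   Context: Fields. On the two-dimensional torus $\mathbb T^2$, let $\phi_\ell$ ($\ell\ge1$) be measurable functions with $|\phi_\ell(x)|\le1$, and let $f_\xi(x)=b+\sum_{\ell\ge1}\omega_\ell\xi_\ell\phi_\ell(x)$ for $\xi\in\mathcal X_\xi=[-1,1]^{\mathbb N}$ (with its product $\sigma$-algebra), where $\sum_{\ell\ge1}|\omega_\ell|<\min\{b,1-b\}$, so that $0<f_\xi(x)<1$. Put $q_\xi=q_{\max}f_\xi$ with $q_{\max}>0$. The space of reaction fields is a measurable space on which $\mu_0$ is defined and on which $q\mapsto L(q;y)$ below is measurable. Forward observables. Let $\lambda>0$, let $(\mathsf B_t)$ be Brownian motion on $\mathbb T^2$ with generator $\frac12\Delta$, and let $T\sim\operatorname{Exp}(\lambda)$ (rate $\lambda$) be independent of $\mathsf B$. For a sensor $s\in\mathbb T^2$, $p_s(q)=u_q(s)=\mathbb E_s[\exp\{-\int_0^Tq(\mathsf B_t)\,\mathrm dt\}]$, where $u_q$ solves $(\lambda+q-\frac12\Delta)u_q=\lambda$ on $\mathbb T^2$. For sensors $s_1,\dots,s_J$ put $p_j(q)=p_{s_j}(q)$. The data $y\in[0,1]^J$ have independent Gaussian errors of variances $\sigma_j^2>0$; $a_j=1/(2\sigma_j^2)$; $L(q;y)=\exp\{-\sum_{j=1}^Ja_j[p_j(q)-y_j]^2\}$. Poisson-killing forward coin for $p_s(q_\xi)$: draw $T$ and an independent homogeneous Poisson process of rate $q_{\max}$ on $[0,T]$; at each event time $t$, in order, simulate $\mathsf B_t$ (with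 $\mathsf B_0=s$) and generate an independent Bernoulli killing mark with success probability $q_\xi(\mathsf B_t)/q_{\max}=f_\xi(\mathsf B_t)$; return $0$ at the first success, and return $1$ if no mark succeeds. Each mark, at $x=\mathsf B_t$, is generated lazily: draw a fresh $U\sim\operatorname{Unif}(0,1)$ and inspect the coefficients $\xi_1,\xi_2,\dots$ of the candidate one after another until, with $S_r=b+\sum_{\ell\le r}\omega_\ell\xi_\ell\phi_\ell(x)$ and $R_r=\sum_{\ell>r}|\omega_\ell|$, either $U<S_r-R_r$ (return $1$) or $U>S_r+R_r$ (return $0$). Repeated forward coins use independent auxiliary randomness given the candidate. Likelihood factory. For an integer $n\ge2$, scalar $y\in[0,1]$ and $0\le k\le n$: $\beta_{k,n}(y)=y^2-\frac{2yk}{n}+\frac{k(k-1)}{n(n-1)}$, $b_n(y)=-\min_{0\le k\le n}\beta_{k,n}(y)$, $c_{k,n}(y)=\beta_{k,n}(y)+b_n(y)$, $C_n(y)=\max\{1,\max_kc_{k,n}(y)\}$. Choose orders $\boldsymbol n=(n_1,\dots,n_J)$, $n_j\ge2$, and put $B_{\boldsymbol n}(y)=\sum_{j=1}^Ja_jb_{n_j}(y_j)$. The $j$-th component coin for candidate $q$: draw $R\sim\operatorname{Poisson}(a_jC_{n_j}(y_j))$ and $R$ independent auxiliary variables, each generated by counting the successes $K$ in $n_j$ independent forward coins for $p_j(q)$ and then drawing a Bernoulli variable with success probability $c_{K,n_j}(y_j)/C_{n_j}(y_j)$; the coin succeeds iff all $R$ auxiliary variables are zero. Component coins are independent given the candidate,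 and coins of different candidates are conditionally independent. The scale $\gamma>0$ is arbitrary. *)

theory Defs
  imports "HOL-Probability.Probability"
begin

section \<open>The flat torus\<close>

definition torus_rel :: "real \<times> real \<Rightarrow> real \<times> real \<Rightarrow> bool" where
  "torus_rel x y \<longleftrightarrow> fst x - fst y \<in> \<int> \<and> snd x - snd y \<in> \<int>"

lemma equivp_torus_rel: "equivp torus_rel"
proof (rule equivpI)
  show "reflp torus_rel"
    by (simp add: reflp_def torus_rel_def)
  show "symp torus_rel"
    unfolding symp_def torus_rel_def by (metis Ints_minus minus_diff_eq)
  show "transp torus_rel"
  proof (rule transpI)
    fix x y z assume "torus_rel x y" "torus_rel y z"
    then have "(fst x - fst y) + (fst y - fst z) \<in> \<int>" "(snd x - snd y) + (snd y - snd z) \<in> \<int>"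
      unfolding torus_rel_def by (blast intro: Ints_add)+
    then show "torus_rel x z" by (simp add: torus_rel_def)
  qed
qed

quotient_type torus = "real \<times> real" / torus_rel
  by (rule equivp_torus_rel)

lift_definition torus_proj :: "real \<times> real \<Rightarrow> torus" is "\<lambda>x. x" .

lift_definition torus_translate :: "torus \<Rightarrow> real \<times> real \<Rightarrow> torus" is "\<lambda>x v. x + v"
  by (simp add: torus_rel_def)

text \<open>The quotient \<open>\<sigma>\<close>-algebra.  It coincides with the Borel \<open>\<sigma>\<close>-algebra of the quotient
  topology, because the projection restricts to a Borel isomorphism on a fundamental domain.\<close>

definition torus_borel :: "torus measure" where
  "torus_borel = sigma UNIV {A. torus_proj -` A \<in> sets borel}"

section \<open>Brownian motion\<close>

text \<open>Standard planar Brownian motion (covariance \<open>t\<close> times the identity, so its generator is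
  half the Laplacian).\<close>

definition planar_brownian_motion :: "'p measure \<Rightarrow> (real \<Rightarrow> 'p \<Rightarrow> real \<times> real) \<Rightarrow> bool" where
  "planar_brownian_motion P W \<longleftrightarrow>
     prob_space P \<and>
     (\<forall>t\<ge>0. W t \<in> borel_measurable P) \<and>
     (\<forall>p\<in>space P. W 0 p = 0) \<and>
     (\<forall>p\<in>space P. continuous_on {0..} (\<lambda>t. W t p)) \<and>
     (\<forall>t u. 0 \<le> t \<longrightarrow> t < u \<longrightarrow>
        distr P borel (\<lambda>p. W u p - W t p) =
          density lborel (normal_density 0 (sqrt (u - t))) \<Otimes>\<^sub>M
          density lborel (normal_density 0 (sqrt (u - t)))) \<and>
     (\<forall>(t :: nat \<Rightarrow> real) m. 0 \<le> t 0 \<longrightarrow> mono t \<longrightarrow>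
        prob_space.indep_vars P (\<lambda>_. borel) (\<lambda>i p. W (t (Suc i)) p - W (t i) p) {..<m})"

text \<open>Brownian motion on the torus started at \<open>s\<close>: the projection of a planar Brownian motion
  started at a representative of \<open>s\<close>.\<close>

definition torus_path :: "(real \<Rightarrow> 'p \<Rightarrow> real \<times> real) \<Rightarrow> torus \<Rightarrow> real \<Rightarrow> 'p \<Rightarrow> torus" where
  "torus_path W s t p = torus_translate s (W t p)"

section \<open>Poisson point processes\<close>

text \<open>The space of all measures on \<open>S\<close> with the \<open>\<sigma>\<close>-algebra generated by the evaluations at
  measurable sets; point processes are random elements of it.\<close>

definition measure_algebra :: "'a measure \<Rightarrow> 'a measure measure" where
  "measure_algebra S =
     (SUP A \<in> sets S. vimage_algebra {N. sets N = sets S} (\<lambda>N. emeasure N A) borel)"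

definition poisson_point_process ::
    "'w measure \<Rightarrow> 'a measure \<Rightarrow> ('w \<Rightarrow> 'a measure) \<Rightarrow> bool" where
  "poisson_point_process M \<Lambda> \<eta> \<longleftrightarrow>
     \<eta> \<in> measurable M (measure_algebra \<Lambda>) \<and>
     (\<forall>\<omega>\<in>space M. \<forall>A\<in>sets \<Lambda>. emeasure (\<eta> \<omega>) A \<in> insert \<infinity> (range of_nat)) \<and>
     (\<forall>A\<in>sets \<Lambda>. emeasure \<Lambda> A < \<infinity> \<longrightarrow>
        (\<forall>k::nat. measure M {\<omega>\<in>space M. emeasure (\<eta> \<omega>) A = of_nat k} =
            measure \<Lambda> A ^ k / fact k * exp (- measure \<Lambda> A))) \<and>
     (\<forall>A\<in>sets \<Lambda>. emeasure \<Lambda> A = \<infinity> \<longrightarrow> (AE \<omega> in M. emeasure (\<eta> \<omega>) A = \<infinity>)) \<and>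
     (\<forall>(A :: nat \<Rightarrow> 'a set) m. (\<forall>i<m. A i \<in> sets \<Lambda>) \<longrightarrow> disjoint_family_on A {..<m} \<longrightarrow>
        prob_space.indep_vars M (\<lambda>_. borel) (\<lambda>i \<omega>. emeasure (\<eta> \<omega>) (A i)) {..<m})"

text \<open>The sum of the unit masses at the points \<open>x i\<close>, \<open>i \<in> I\<close>, counted with multiplicity.\<close>

definition point_configuration :: "'a measure \<Rightarrow> 'i set \<Rightarrow> ('i \<Rightarrow> 'a) \<Rightarrow> 'a measure" where
  "point_configuration S I x = distr (count_space I) S x"

text \<open>\<open>\<tau> 0, \<tau> 1, \<dots>\<close> are the ordered event times of a homogeneous Poisson process on
  \<open>[0, \<infinity>)\<close>.\<close>

definition homogeneous_poisson_process :: "'h measure \<Rightarrow> real \<Rightarrow> (nat \<Rightarrow> 'h \<Rightarrow> real) \<Rightarrow> bool" where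
  "homogeneous_poisson_process H rate \<tau> \<longleftrightarrow>
     prob_space H \<and>
     (\<forall>k. \<tau> k \<in> borel_measurable H) \<and>
     (\<forall>h\<in>space H. mono (\<lambda>k. \<tau> k h)) \<and>
     poisson_point_process H (density lborel (\<lambda>t. ennreal (rate * indicator {0..} t)))
       (\<lambda>h. point_configuration borel UNIV (\<lambda>k. \<tau> k h))"

section \<open>Random series fields\<close>

text \<open>Series terms are indexed from \<open>0\<close>, so \<open>l :: nat\<close> stands for the term number \<open>l + 1\<close>.\<close>

definition coefficient_space :: "(nat \<Rightarrow> real) measure" where
  "coefficient_space = (\<Pi>\<^sub>M l\<in>UNIV. restrict_space borel {-1..1})"

definition series_field ::
    "real \<Rightarrow> (nat \<Rightarrow> real) \<Rightarrow> (nat \<Rightarrow> torus \<Rightarrow> real) \<Rightarrow> (nat \<Rightarrow> real) \<Rightarrow> torus \<Rightarrow> real" where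
  "series_field b w \<phi> \<xi> x = b + (\<Sum>l. w l * \<xi> l * \<phi> l x)"

definition reaction_field ::
    "real \<Rightarrow> real \<Rightarrow> (nat \<Rightarrow> real) \<Rightarrow> (nat \<Rightarrow> torus \<Rightarrow> real) \<Rightarrow> (nat \<Rightarrow> real) \<Rightarrow> torus \<Rightarrow> real" where
  "reaction_field qmax b w \<phi> \<xi> = (\<lambda>x. qmax * series_field b w \<phi> \<xi> x)"

definition partial_field ::
    "real \<Rightarrow> (nat \<Rightarrow> real) \<Rightarrow> (nat \<Rightarrow> torus \<Rightarrow> real) \<Rightarrow> (nat \<Rightarrow> real) \<Rightarrow> torus \<Rightarrow> nat \<Rightarrow> real" where
  "partial_field b w \<phi> \<xi> x r = b + (\<Sum>l<r. w l * \<xi> l * \<phi> l x)"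

definition tail_bound :: "(nat \<Rightarrow> real) \<Rightarrow> nat \<Rightarrow> real" where
  "tail_bound w r = (\<Sum>l. \<bar>w (l + r)\<bar>)"

section \<open>Forward observables and likelihood\<close>

definition survival_prob ::
    "real \<Rightarrow> 'p measure \<Rightarrow> (real \<Rightarrow> 'p \<Rightarrow> real \<times> real) \<Rightarrow> torus \<Rightarrow> (torus \<Rightarrow> real) \<Rightarrow> real" where
  "survival_prob lam P W s q =
     (\<integral>(t, p). exp (- (LINT v:{0..t}|lborel. q (torus_path W s v p)))
        \<partial>(density lborel (exponential_density lam) \<Otimes>\<^sub>M P))"

definition likelihood ::
    "real \<Rightarrow> 'p measure \<Rightarrow> (real \<Rightarrow> 'p \<Rightarrow> real \<times> real) \<Rightarrow> nat \<Rightarrow> (nat \<Rightarrow> torus) \<Rightarrow> (nat \<Rightarrow> real) \<Rightarrow>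
     (nat \<Rightarrow> real) \<Rightarrow> (torus \<Rightarrow> real) \<Rightarrow> real" where
  "likelihood lam P W J s a y q =
     exp (- (\<Sum>j<J. a j * (survival_prob lam P W (s j) q - y j)\<^sup>2))"

section \<open>Poisson-killing forward coins\<close>

text \<open>Every coin is a deterministic function of the candidate's coefficients and of a seed holding
  all the auxiliary randomness; a coin is identified with the event that it returns \<open>1\<close>.\<close>

definition unit_uniform :: "real measure" where
  "unit_uniform = uniform_measure lborel {0<..<1}"

text \<open>The lazy Bernoulli mark at \<open>x\<close>: \<open>r\<close> is the number of coefficients inspected when the
  comparison of \<open>u\<close> with the enclosing interval is first decisive.  A mark that is never decided
  (which forces \<open>u\<close> to equal the field value, a null event) counts as a failure.\<close>

definition lazy_mark ::
    "real \<Rightarrow> (nat \<Rightarrow> real) \<Rightarrow> (nat \<Rightarrow> torus \<Rightarrow> real) \<Rightarrow> (nat \<Rightarrow> real) \<Rightarrow> torus \<Rightarrow> real \<Rightarrow> bool" where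
  "lazy_mark b w \<phi> \<xi> x u \<longleftrightarrow>
     (\<exists>r. u < partial_field b w \<phi> \<xi> x r - tail_bound w r \<and>
        (\<forall>r'<r. \<not> u < partial_field b w \<phi> \<xi> x r' - tail_bound w r' \<and>
                \<not> u > partial_field b w \<phi> \<xi> x r' + tail_bound w r'))"

text \<open>A forward seed holds the exponential time, the Poisson process, the Brownian path and the
  uniform variables of the killing marks.\<close>

type_synonym ('h, 'p) forward_seed = "real \<times> 'h \<times> 'p \<times> (nat \<Rightarrow> real)"

definition forward_seed_space ::
    "real \<Rightarrow> 'h measure \<Rightarrow> 'p measure \<Rightarrow> ('h, 'p) forward_seed measure" where
  "forward_seed_space lam H P =
     density lborel (exponential_density lam) \<Otimes>\<^sub>M H \<Otimes>\<^sub>M P \<Otimes>\<^sub>M (\<Pi>\<^sub>M k\<in>UNIV. unit_uniform)"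

definition forward_coin ::
    "real \<Rightarrow> (nat \<Rightarrow> real) \<Rightarrow> (nat \<Rightarrow> torus \<Rightarrow> real) \<Rightarrow> (nat \<Rightarrow> 'h \<Rightarrow> real) \<Rightarrow>
     (real \<Rightarrow> 'p \<Rightarrow> real \<times> real) \<Rightarrow> (nat \<Rightarrow> real) \<Rightarrow> torus \<Rightarrow> ('h, 'p) forward_seed \<Rightarrow> bool" where
  "forward_coin b w \<phi> \<tau> W \<xi> s = (\<lambda>(t, h, p, u).
     \<not> (\<exists>k. 0 \<le> \<tau> k h \<and> \<tau> k h \<le> t \<and> lazy_mark b w \<phi> \<xi> (torus_path W s (\<tau> k h) p) (u k)))"

section \<open>Bernstein--Poisson likelihood factory\<close>

definition bernstein_coeff :: "nat \<Rightarrow> nat \<Rightarrow> real \<Rightarrow> real" where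
  "bernstein_coeff k n y =
     y\<^sup>2 - 2 * y * real k / real n + real k * (real k - 1) / (real n * (real n - 1))"

definition bernstein_shift :: "nat \<Rightarrow> real \<Rightarrow> real" where
  "bernstein_shift n y = - Min ((\<lambda>k. bernstein_coeff k n y) ` {0..n})"

definition shifted_coeff :: "nat \<Rightarrow> nat \<Rightarrow> real \<Rightarrow> real" where
  "shifted_coeff k n y = bernstein_coeff k n y + bernstein_shift n y"

definition coeff_scale :: "nat \<Rightarrow> real \<Rightarrow> real" where
  "coeff_scale n y = max 1 (Max ((\<lambda>k. shifted_coeff k n y) ` {0..n}))"

definition total_shift :: "nat \<Rightarrow> (nat \<Rightarrow> real) \<Rightarrow> (nat \<Rightarrow> nat) \<Rightarrow> (nat \<Rightarrow> real) \<Rightarrow> real" where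
  "total_shift J a n y = (\<Sum>j<J. a j * bernstein_shift (n j) (y j))"

text \<open>The seed of a component coin holds the Poisson number of auxiliary variables and, for each
  of these, a uniform variable (for the Bernoulli draw) and the seeds of its forward coins.\<close>

type_synonym 'z component_seed = "nat \<times> (nat \<Rightarrow> real \<times> (nat \<Rightarrow> 'z))"

definition component_seed_space ::
    "'z measure \<Rightarrow> real \<Rightarrow> nat \<Rightarrow> real \<Rightarrow> 'z component_seed measure" where
  "component_seed_space F a n y =
     measure_pmf (poisson_pmf (a * coeff_scale n y)) \<Otimes>\<^sub>M
     (\<Pi>\<^sub>M r\<in>UNIV. unit_uniform \<Otimes>\<^sub>M (\<Pi>\<^sub>M m\<in>UNIV. F))"

definition auxiliary_variable ::
    "('z \<Rightarrow> bool) \<Rightarrow> nat \<Rightarrow> real \<Rightarrow> real \<times> (nat \<Rightarrow> 'z) \<Rightarrow> bool" where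
  "auxiliary_variable coin n y = (\<lambda>(v, z).
     v < shifted_coeff (card {m. m < n \<and> coin (z m)}) n y / coeff_scale n y)"

definition component_coin ::
    "('z \<Rightarrow> bool) \<Rightarrow> nat \<Rightarrow> real \<Rightarrow> 'z component_seed \<Rightarrow> bool" where
  "component_coin coin n y = (\<lambda>(R, x). \<forall>r<R. \<not> auxiliary_variable coin n y (x r))"

definition candidate_seed_space ::
    "'z measure \<Rightarrow> nat \<Rightarrow> (nat \<Rightarrow> real) \<Rightarrow> (nat \<Rightarrow> nat) \<Rightarrow> (nat \<Rightarrow> real) \<Rightarrow>
     (nat \<Rightarrow> 'z component_seed) measure" where
  "candidate_seed_space F J a n y = (\<Pi>\<^sub>M j\<in>{..<J}. component_seed_space F (a j) (n j) (y j))"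

definition retain_candidate ::
    "(torus \<Rightarrow> 'z \<Rightarrow> bool) \<Rightarrow> nat \<Rightarrow> (nat \<Rightarrow> torus) \<Rightarrow> (nat \<Rightarrow> nat) \<Rightarrow> (nat \<Rightarrow> real) \<Rightarrow>
     (nat \<Rightarrow> 'z component_seed) \<Rightarrow> bool" where
  "retain_candidate coin J s n y \<zeta> \<longleftrightarrow> (\<forall>j<J. component_coin (coin (s j)) (n j) (y j) (\<zeta> j))"

end

theory Submission
  imports Defs
begin

text \<open>
  The theorem is an instance of independent thinning of a Poisson process, once every source of
  randomness inside a coin has been integrated out.  All the point process arguments go through
  one functional of a configuration: for \<open>0 \<le> h \<le> 1\<close>, the expectation of the product of
  \<open>h\<close> over the points.  For a Poisson process with finite intensity \<open>\<Lambda>\<close> it equals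
  \<open>exp (- \<integral> (1 - h) d\<Lambda>)\<close>.  A product of this kind survives conditioning and thinning without
  any reference to the order in which the points are listed, which matters because the candidates
  are given as an enumeration whose order may depend on their positions.

  Four facts carry the proof.

  First, \<open>poisson_laplace_functional\<close> computes the functional of an abstract Poisson process from
  the laws and the independence of its counts, by approximating \<open>h\<close> with finitely many levels.
  It is applied twice: to the event times of a killing clock and to the master process of
  candidates.

  Second, a forward coin succeeds exactly when no event time \<open>v\<close> up to the exponential time
  carries a uniform variable below \<open>f (B v)\<close>; the lazy inspection of the coefficients decides
  this comparison without error (\<open>lazy_mark_iff\<close>).  Integrating first the uniform variables and
  then the event times gives \<open>exp (- \<integral> q (B v) dv)\<close>, so a coin has success probability
  \<open>p\<^sub>s(q)\<close> with no spatial discretization (\<open>forward_coin_prob\<close>).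

  Third, the coefficients of the likelihood factory are those of the Bernstein form of
  \<open>(p - y)\<^sup>2\<close>, shifted to be nonnegative; hence an auxiliary variable has success probability
  \<open>((p - y)\<^sup>2 + b) / C\<close>, and a Poisson number of rate \<open>a C\<close> of them contains no success with
  probability \<open>exp (- a ((p - y)\<^sup>2 + b))\<close>.  The product over the sensors is \<open>L(q) exp (- B)\<close>
  (\<open>retain_candidate_prob\<close>), and the intensity of the master process contains the factor
  \<open>exp B\<close> that cancels the shift.

  Fourth, the functional characterizes the process.  Taking \<open>h\<close> to be a product of factors
  \<open>s\<close> on a set and \<open>1\<close> off it yields joint probability generating functions of counts, and a
  joint generating function on the unit cube determines the joint law of finitely many counts
  (\<open>joint_pgf_unique\<close>).  In the locale \<open>poisson_laplace\<close> this gives both the Poisson property and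
  the conditional law given the number of points: the coefficient of \<open>t\<^sup>k\<close> in
  \<open>exp (c t \<integral> h d\<mu> - c)\<close> is proportional to \<open>(\<integral> h d\<mu>)\<^sup>k\<close>, the functional of \<open>k\<close>
  independent draws from \<open>\<mu>\<close>.
\<close>

section \<open>The measurable space of point configurations\<close>

lemma space_measure_algebra: "space (measure_algebra S) = {N. sets N = sets S}"
  by (auto simp: measure_algebra_def space_Sup_eq_UN)

lemma measurable_emeasure_measure_algebra:
  "A \<in> sets S \<Longrightarrow> (\<lambda>N. emeasure N A) \<in> borel_measurable (measure_algebra S)"
  by (auto intro!: measurable_Sup1 measurable_vimage_algebra1 simp: measure_algebra_def)

lemma measurable_measure_algebra:
  "(\<And>a. a \<in> space M \<Longrightarrow> sets (K a) = sets S) \<Longrightarrow>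
   (\<And>A. A \<in> sets S \<Longrightarrow> (\<lambda>a. emeasure (K a) A) \<in> borel_measurable M) \<Longrightarrow>
   K \<in> measurable M (measure_algebra S)"
  by (auto intro!: measurable_Sup2 measurable_vimage_algebra2 simp: measure_algebra_def)

lemma measure_algebra_cong: "sets S = sets S' \<Longrightarrow> measure_algebra S = measure_algebra S'"
  by (simp add: measure_algebra_def)

text \<open>The events that constrain finitely many evaluations generate the \<open>\<sigma>\<close>-algebra and are closed under
intersection.  Indexing them by finite sets of pairs makes an intersection the union of the index
sets.\<close>

lemma measure_eqI_measure_algebra:
  assumes sets: "sets \<mu> = sets (measure_algebra S)" "sets \<mu>' = sets (measure_algebra S)"
    and fin: "finite_measure \<mu>"
    and eq: "\<And>F. finite F \<Longrightarrow> F \<subseteq> sets S \<times> sets borel \<Longrightarrow>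
      emeasure \<mu> {N. sets N = sets S \<and> (\<forall>(A, B)\<in>F. emeasure N A \<in> B)} =
      emeasure \<mu>' {N. sets N = sets S \<and> (\<forall>(A, B)\<in>F. emeasure N A \<in> B)}"
  shows "\<mu> = \<mu>'"
proof -
  let ?X = "{N. sets N = sets S}"
  let ?G = "\<lambda>F. {N. sets N = sets S \<and> (\<forall>(A, B)\<in>F. emeasure N A \<in> B)}"
  let ?E = "{?G F | F. finite F \<and> F \<subseteq> sets S \<times> sets borel}"
  interpret finite_measure \<mu> by fact
  have sub: "?E \<subseteq> Pow ?X" by auto
  have gen: "sets (measure_algebra S) = sigma_sets ?X ?E"
  proof
    have "sets (measure_algebra S) =
      sigma_sets ?X (\<Union>A\<in>sets S. sets (vimage_algebra ?X (\<lambda>N. emeasure N A) borel))"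
      unfolding measure_algebra_def by (subst sets_Sup_eq[where X = ?X]) auto
    also have "\<dots> \<subseteq> sigma_sets ?X ?E"
    proof (rule sigma_sets_mono, safe)
      fix A Y assume A: "A \<in> sets S" and "Y \<in> sets (vimage_algebra ?X (\<lambda>N. emeasure N A) borel)"
      then obtain B where B: "B \<in> sets borel" "Y = (\<lambda>N. emeasure N A) -` B \<inter> ?X"
        by (auto simp: sets_vimage_algebra2)
      then have "Y = ?G {(A, B)}" by auto
      with A B show "Y \<in> sigma_sets ?X ?E"
        by (intro sigma_sets.Basic) (blast intro: finite.intros)
    qed
    finally show "sets (measure_algebra S) \<subseteq> sigma_sets ?X ?E" .
    have "?E \<subseteq> sets (measure_algebra S)"
    proof safe
      fix F :: "('a set \<times> ennreal set) set" assume F: "finite F" "F \<subseteq> sets S \<times> sets borel"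
      have "?G F = {N \<in> space (measure_algebra S). \<forall>p\<in>F. emeasure N (fst p) \<in> snd p}"
        by (auto simp: space_measure_algebra)
      also have "\<dots> \<in> sets (measure_algebra S)"
      proof (rule sets.sets_Collect_finite_All)
        fix p assume "p \<in> F"
        then have "fst p \<in> sets S" and B[measurable]: "snd p \<in> sets borel" using F by auto
        note measurable_emeasure_measure_algebra[OF this(1), measurable]
        show "{N \<in> space (measure_algebra S). emeasure N (fst p) \<in> snd p} \<in> sets (measure_algebra S)"
          by measurable
      qed (use F in simp)
      finally show "?G F \<in> sets (measure_algebra S)" .
    qed
    from sets.sigma_sets_subset[OF this] show "sigma_sets ?X ?E \<subseteq> sets (measure_algebra S)"
      by (simp add: space_measure_algebra)
  qed
  show ?thesis
  proof (rule measure_eqI_generator_eq[OF _ sub, where A = "\<lambda>_. ?X"])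
    show "Int_stable ?E"
    proof (rule Int_stableI)
      fix X Y assume "X \<in> ?E" "Y \<in> ?E"
      then obtain F F' where F: "finite F" "F \<subseteq> sets S \<times> sets borel" "X = ?G F"
        "finite F'" "F' \<subseteq> sets S \<times> sets borel" "Y = ?G F'" by blast
      then have "X \<inter> Y = ?G (F \<union> F')" by auto
      with F show "X \<inter> Y \<in> ?E" by (intro CollectI exI[of _ "F \<union> F'"]) auto
    qed
    show "emeasure \<mu> X = emeasure \<mu>' X" if "X \<in> ?E" for X using that eq by blast
    show "range (\<lambda>_. ?X) \<subseteq> ?E" by (auto intro!: exI[of _ "{}"])
    show "sets \<mu> = sigma_sets ?X ?E" "sets \<mu>' = sigma_sets ?X ?E" using sets gen by auto
  qed (auto simp: emeasure_eq_measure)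
qed

section \<open>Generating functions of counts\<close>

text \<open>Generating functions are available on one side of \<open>0\<close> only, so the identity theorem for
power series on a neighbourhood of \<open>0\<close> does not apply; the coefficients are instead peeled off one at a time, by
dividing by \<open>s ^ k\<close> and letting \<open>s\<close> tend to \<open>0\<close> from the right.\<close>

lemma power_series_coeff_zero:
  fixes c :: "nat \<Rightarrow> real"
  assumes sums: "\<And>s. 0 < s \<Longrightarrow> s < 1 \<Longrightarrow> (\<lambda>k. c k * s ^ k) sums 0"
  shows "c k = 0"
proof (induction k rule: less_induct)
  case (less k)
  define g where "g x = (\<Sum>j. c (j + k) * x ^ j)" for x
  have sums': "(\<lambda>j. c (j + k) * s ^ j) sums 0" if s: "0 < s" "s < 1" for s
  proof -
    have "(\<lambda>j. c (j + k) * s ^ (j + k)) sums (0 - (\<Sum>i<k. c i * s ^ i))"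
      by (rule sums_split_initial_segment[OF sums[OF s]])
    then have "(\<lambda>j. c (j + k) * s ^ j * s ^ k) sums 0"
      using less by (simp add: power_add mult.assoc)
    from sums_divide[OF this, of "s ^ k"] s show ?thesis by simp
  qed
  have "isCont g 0"
    unfolding g_def by (rule isCont_powser[where K = "1/2"]) (use sums'[of "1/2"] sums_summable in auto)
  then have "(g \<longlongrightarrow> g 0) (at_right 0)"
    unfolding isCont_def by (rule filterlim_mono[OF _ order_refl at_le]) auto
  moreover have "\<forall>\<^sub>F x in at_right 0. g x = 0"
    unfolding eventually_at_right_field g_def using sums_unique[OF sums'] by (intro exI[of _ 1]) auto
  then have "(g \<longlongrightarrow> 0) (at_right 0)" by (rule tendsto_eventually)
  ultimately have "g 0 = 0" by (rule tendsto_unique[rotated]) simp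
  then show ?case by (simp add: g_def)
qed

text \<open>The weight \<open>X\<close> lets the law of one count be read off while all other counts are kept inside the
integral.\<close>

lemma (in finite_measure) integral_nat_valued_sums:
  fixes X :: "'a \<Rightarrow> real" and f :: "nat \<Rightarrow> real"
  assumes [measurable]: "X \<in> borel_measurable M" "K \<in> measurable M (count_space UNIV)"
    and X: "\<And>x. x \<in> space M \<Longrightarrow> \<bar>X x\<bar> \<le> C" and f: "\<And>k. \<bar>f k\<bar> \<le> 1"
  shows "(\<lambda>k. (\<integral>x. X x * indicator {k} (K x) \<partial>M) * f k) sums (\<integral>x. X x * f (K x) \<partial>M)"
proof -
  have C: "0 \<le> C" if "space M \<noteq> {}" using X that by fastforce
  have [measurable]: "(\<lambda>x. indicator {k} (K x) :: real) \<in> borel_measurable M" for k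
    by (rule measurable_compose[OF assms(2)]) simp
  have int: "integrable M (\<lambda>x. X x * indicator {k} (K x) * f k)" for k
  proof (rule integrable_const_bound[where B = C])
    show "AE x in M. norm (X x * indicator {k} (K x) * f k) \<le> C"
      using C by (intro AE_I2)
        (auto split: split_indicator simp: abs_mult intro!: mult_left_le[THEN order_trans, OF f] X)
  qed simp
  have part: "(\<Sum>k<m. X x * indicator {k} (K x) * f k) = (if K x < m then X x * f (K x) else 0)" for m x
  proof -
    have "(\<Sum>k<m. X x * indicator {k} (K x) * f k) = (\<Sum>k<m. if K x = k then X x * f k else 0)"
      by (intro sum.cong) (auto split: split_indicator)
    then show ?thesis by (simp add: sum.delta')
  qed
  have "(\<lambda>m. \<integral>x. (\<Sum>k<m. X x * indicator {k} (K x) * f k) \<partial>M) \<longlonglongrightarrow> (\<integral>x. X x * f (K x) \<partial>M)"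
  proof (rule integral_dominated_convergence[where w = "\<lambda>_. C"])
    show "AE x in M. (\<lambda>m. \<Sum>k<m. X x * indicator {k} (K x) * f k) \<longlonglongrightarrow> X x * f (K x)"
      unfolding part
    proof (intro AE_I2 tendsto_eventually)
      fix x show "\<forall>\<^sub>F m in sequentially. (if K x < m then X x * f (K x) else 0) = X x * f (K x)"
        by (rule eventually_mono[OF eventually_gt_at_top[of "K x"]]) simp
    qed
    show "AE x in M. norm (\<Sum>k<m. X x * indicator {k} (K x) * f k) \<le> C" for m
      unfolding part using C
      by (intro AE_I2) (auto simp: abs_mult intro!: mult_left_le[THEN order_trans, OF f] X)
  qed auto
  also have "(\<lambda>m. \<integral>x. (\<Sum>k<m. X x * indicator {k} (K x) * f k) \<partial>M) =
    (\<lambda>m. \<Sum>k<m. (\<integral>x. X x * indicator {k} (K x) \<partial>M) * f k)"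
    using int by (simp add: Bochner_Integration.integral_sum)
  finally show ?thesis unfolding sums_def .
qed

lemma pgf_determines_coefficients:
  fixes X :: "'a \<Rightarrow> real" and X' :: "'b \<Rightarrow> real"
  assumes fin: "finite_measure M" "finite_measure M'"
    and [measurable]: "X \<in> borel_measurable M" "K \<in> measurable M (count_space UNIV)"
      "X' \<in> borel_measurable M'" "K' \<in> measurable M' (count_space UNIV)"
    and X: "\<And>x. x \<in> space M \<Longrightarrow> \<bar>X x\<bar> \<le> C" "\<And>x. x \<in> space M' \<Longrightarrow> \<bar>X' x\<bar> \<le> C"
    and eq: "\<And>s. 0 \<le> s \<Longrightarrow> s \<le> 1 \<Longrightarrow> (\<integral>x. X x * s ^ K x \<partial>M) = (\<integral>x. X' x * s ^ K' x \<partial>M')"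
  shows "(\<integral>x. X x * indicator {k} (K x) \<partial>M) = (\<integral>x. X' x * indicator {k} (K' x) \<partial>M')"
proof -
  interpret M: finite_measure M by fact
  interpret M': finite_measure M' by fact
  define c where "c k = (\<integral>x. X x * indicator {k} (K x) \<partial>M) - (\<integral>x. X' x * indicator {k} (K' x) \<partial>M')" for k
  have "(\<lambda>k. c k * s ^ k) sums 0" if s: "0 < s" "s < 1" for s
  proof -
    have le: "\<bar>s ^ k\<bar> \<le> 1" for k using s by (simp add: power_le_one)
    from sums_diff[OF M.integral_nat_valued_sums[of X K C "\<lambda>k. s ^ k"]
        M'.integral_nat_valued_sums[of X' K' C "\<lambda>k. s ^ k"]]
    show ?thesis using le X eq[of s] s by (simp add: c_def left_diff_distrib)
  qed
  from power_series_coeff_zero[of c, OF this] show ?thesis by (simp add: c_def)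
qed

text \<open>The powers \<open>s i ^ k\<close> are replaced by the functions \<open>f i\<close> one index at a time: with all other
factors frozen in the weight, the generating function in the remaining variable determines the
coefficients, and these determine the integral of any bounded function of the count.\<close>

lemma joint_pgf_unique:
  fixes K :: "'i \<Rightarrow> 'a \<Rightarrow> nat" and K' :: "'i \<Rightarrow> 'b \<Rightarrow> nat" and f :: "'i \<Rightarrow> nat \<Rightarrow> real"
  assumes fin: "finite_measure M" "finite_measure M'" and I: "finite I"
    and K: "\<And>i. i \<in> I \<Longrightarrow> K i \<in> measurable M (count_space UNIV)"
    and K': "\<And>i. i \<in> I \<Longrightarrow> K' i \<in> measurable M' (count_space UNIV)"
    and eq: "\<And>s. (\<And>i. 0 \<le> s i \<and> s i \<le> (1::real)) \<Longrightarrow>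
      (\<integral>x. (\<Prod>i\<in>I. s i ^ K i x) \<partial>M) = (\<integral>x. (\<Prod>i\<in>I. s i ^ K' i x) \<partial>M')"
    and f: "\<And>i k. 0 \<le> f i k \<and> f i k \<le> 1"
  shows "(\<integral>x. (\<Prod>i\<in>I. f i (K i x)) \<partial>M) = (\<integral>x. (\<Prod>i\<in>I. f i (K' i x)) \<partial>M')"
proof -
  interpret M: finite_measure M by fact
  interpret M': finite_measure M' by fact
  have "(\<integral>x. (\<Prod>i\<in>I. f i (K i x)) \<partial>M) = (\<integral>x. (\<Prod>i\<in>I. f i (K' i x)) \<partial>M')"
    if "finite J" "J \<subseteq> I" "\<And>i k. 0 \<le> f i k \<and> f i k \<le> 1"
      "\<And>i. i \<in> I - J \<Longrightarrow> \<exists>s. 0 \<le> s \<and> s \<le> 1 \<and> f i = (\<lambda>k. s ^ k)"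
    for J and f :: "'i \<Rightarrow> nat \<Rightarrow> real"
    using that
  proof (induction J arbitrary: f rule: finite_induct)
    case empty
    then have "\<forall>i. \<exists>s. 0 \<le> s \<and> s \<le> 1 \<and> (i \<in> I \<longrightarrow> f i = (\<lambda>k. s ^ k))"
      by (metis Diff_empty zero_le_one order_refl)
    then obtain s where s: "\<And>i. 0 \<le> s i \<and> s i \<le> 1" "\<And>i. i \<in> I \<Longrightarrow> f i = (\<lambda>k. s i ^ k)"
      by metis
    with eq[of s] show ?case by (simp cong: prod.cong)
  next
    case (insert j J)
    note [measurable] = K K'
    let ?X = "\<lambda>x. \<Prod>i\<in>I - {j}. f i (K i x)" and ?X' = "\<lambda>x. \<Prod>i\<in>I - {j}. f i (K' i x)"
    have j: "j \<in> I" using insert by auto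
    have split: "(\<Prod>i\<in>I. g i (L i x)) = (\<Prod>i\<in>I - {j}. g i (L i x)) * g j (L j x)"
      for g :: "'i \<Rightarrow> nat \<Rightarrow> real" and L :: "'i \<Rightarrow> 'z \<Rightarrow> nat" and x
      using I j by (simp add: prod.remove[of I j] mult.commute)
    have m[measurable]: "?X \<in> borel_measurable M" "?X' \<in> borel_measurable M'"
      using K K' by (auto intro!: borel_measurable_prod measurable_compose[OF _ measurable_count_space])
    have b: "\<bar>?X x\<bar> \<le> 1" "\<bar>?X' y\<bar> \<le> 1" for x y
      using insert.prems(2) by (auto simp: abs_prod intro!: prod_le_1)
    have "(\<integral>x. ?X x * s ^ K j x \<partial>M) = (\<integral>x. ?X' x * s ^ K' j x \<partial>M')" if s: "0 \<le> s" "s \<le> 1" for s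
    proof -
      let ?g = "f(j := \<lambda>k. s ^ k)"
      have "(\<integral>x. (\<Prod>i\<in>I. ?g i (K i x)) \<partial>M) = (\<integral>x. (\<Prod>i\<in>I. ?g i (K' i x)) \<partial>M')"
      proof (rule insert.IH)
        show "J \<subseteq> I" using insert by auto
        show "0 \<le> ?g i k \<and> ?g i k \<le> 1" for i k using insert.prems(2) s by (auto simp: power_le_one)
        show "\<exists>s. 0 \<le> s \<and> s \<le> 1 \<and> ?g i = (^) s" if "i \<in> I - J" for i
          using that insert.prems(3)[of i] s by (cases "i = j") auto
      qed
      then show ?thesis unfolding split by simp
    qed
    then have coeff: "(\<integral>x. ?X x * indicator {k} (K j x) \<partial>M) = (\<integral>x. ?X' x * indicator {k} (K' j x) \<partial>M')" for k
      by (intro pgf_determines_coefficients[where C = 1] fin m K K' j b)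
    have fj: "\<bar>f j k\<bar> \<le> 1" for k using insert.prems(2)[of j k] by auto
    have "(\<lambda>k. (\<integral>x. ?X x * indicator {k} (K j x) \<partial>M) * f j k) sums (\<integral>x. ?X x * f j (K j x) \<partial>M)"
      by (rule M.integral_nat_valued_sums[where C = 1]) (auto intro!: K j b fj m)
    moreover have "(\<lambda>k. (\<integral>x. ?X' x * indicator {k} (K' j x) \<partial>M') * f j k) sums (\<integral>x. ?X' x * f j (K' j x) \<partial>M')"
      by (rule M'.integral_nat_valued_sums[where C = 1]) (auto intro!: K' j b fj m)
    ultimately show ?case unfolding split coeff by (rule sums_unique2)
  qed
  from this[OF I order_refl f] show ?thesis by simp
qed

section \<open>The Laplace functional of a Poisson process\<close>

text \<open>The number of points in \<open>A\<close>, with value \<open>0\<close> when there are infinitely many, as an element of a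
countable type so that powers and generating functions make sense.\<close>

definition count_in :: "'a measure \<Rightarrow> 'a set \<Rightarrow> nat" where
  "count_in N A = nat \<lfloor>enn2real (emeasure N A)\<rfloor>"

lemma count_in_of_nat: "emeasure N A = of_nat k \<Longrightarrow> count_in N A = k"
  by (simp add: count_in_def ennreal_of_nat_eq_real_of_nat)

lemma emeasure_point_configuration:
  assumes "\<And>i. i \<in> I \<Longrightarrow> x i \<in> space S" "A \<in> sets S"
  shows "emeasure (point_configuration S I x) A = emeasure (count_space I) {i \<in> I. x i \<in> A}"
proof -
  have "x \<in> measurable (count_space I) S" using assms by auto
  then show ?thesis
    unfolding point_configuration_def using assms(2)
    by (auto simp: emeasure_distr vimage_def Int_def conj_commute intro!: arg_cong[where f = "emeasure _"])
qed

lemma emeasure_point_configuration_finite: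
  assumes "\<And>i. i \<in> I \<Longrightarrow> x i \<in> space S" "A \<in> sets S" "finite {i \<in> I. x i \<in> A}"
  shows "emeasure (point_configuration S I x) A = of_nat (card {i \<in> I. x i \<in> A})"
  using assms by (subst emeasure_point_configuration) (auto simp: emeasure_count_space)

lemma sets_point_configuration [simp]: "sets (point_configuration S I x) = sets S"
  by (simp add: point_configuration_def)

lemma (in prob_space) poisson_pgf:
  assumes [measurable]: "K \<in> measurable M (count_space UNIV)"
    and pois: "\<And>k. prob {\<omega> \<in> space M. K \<omega> = k} = \<Lambda> ^ k / fact k * exp (- \<Lambda>)"
    and s: "0 \<le> s" "s \<le> (1::real)"
  shows "expectation (\<lambda>\<omega>. s ^ K \<omega>) = exp (- (\<Lambda> * (1 - s)))"
proof -
  have "(\<lambda>k. (\<integral>x. (1::real) * indicator {k} (K x) \<partial>M) * s ^ k) sums (\<integral>x. 1 * s ^ K x \<partial>M)"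
    by (rule integral_nat_valued_sums[where C = 1]) (use s in \<open>auto simp: power_le_one\<close>)
  moreover have "(\<integral>x. (1::real) * indicator {k} (K x) \<partial>M) = \<Lambda> ^ k / fact k * exp (- \<Lambda>)" for k
  proof -
    have "(\<integral>x. (1::real) * indicator {k} (K x) \<partial>M) = (\<integral>x. indicator {\<omega> \<in> space M. K \<omega> = k} x \<partial>M)"
      by (intro Bochner_Integration.integral_cong) (auto split: split_indicator)
    also have "\<dots> = prob {\<omega> \<in> space M. K \<omega> = k}" by simp
    finally show ?thesis by (simp add: pois)
  qed
  moreover have "(\<lambda>k. \<Lambda> ^ k / fact k * exp (- \<Lambda>) * s ^ k) sums (exp (\<Lambda> * s) * exp (- \<Lambda>))"
    using sums_mult2[OF exp_converges[of "\<Lambda> * s"], of "exp (- \<Lambda>)"]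
    by (simp add: power_mult_distrib divide_inverse mult_ac scaleR_conv_of_real)
  ultimately have "(\<integral>x. 1 * s ^ K x \<partial>M) = exp (\<Lambda> * s) * exp (- \<Lambda>)"
    by (auto intro: sums_unique2)
  then show ?thesis by (simp add: exp_add[symmetric] algebra_simps)
qed

text \<open>The probabilities of the finite values already sum to \<open>1\<close>.\<close>

lemma poisson_count_AE_finite:
  assumes "prob_space M" and ppp: "poisson_point_process M \<Lambda> \<eta>"
    and A: "A \<in> sets \<Lambda>" "emeasure \<Lambda> A < \<infinity>"
  shows "AE \<omega> in M. emeasure (\<eta> \<omega>) A = of_nat (count_in (\<eta> \<omega>) A)"
proof -
  interpret prob_space M by fact
  have \<eta>: "\<eta> \<in> measurable M (measure_algebra \<Lambda>)" using ppp by (simp add: poisson_point_process_def)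
  have [measurable]: "(\<lambda>\<omega>. emeasure (\<eta> \<omega>) A) \<in> borel_measurable M"
    using measurable_compose[OF \<eta> measurable_emeasure_measure_algebra[OF A(1)]] .
  let ?E = "\<lambda>k. {\<omega> \<in> space M. emeasure (\<eta> \<omega>) A = of_nat k}"
  have "(\<lambda>k. prob (?E k)) sums prob (\<Union>k. ?E k)"
    by (rule finite_measure_UNION) (auto simp: disjoint_family_on_def)
  moreover have "(\<lambda>k. prob (?E k)) sums (exp (measure \<Lambda> A) * exp (- measure \<Lambda> A))"
    using ppp A sums_mult2[OF exp_converges[of "measure \<Lambda> A"], of "exp (- measure \<Lambda> A)"]
    by (simp add: poisson_point_process_def divide_inverse mult_ac scaleR_conv_of_real)
  ultimately have "prob (\<Union>k. ?E k) = 1"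
    using sums_unique2 by (fastforce simp: exp_minus)
  then have "AE \<omega> in M. \<omega> \<in> (\<Union>k. ?E k)"
    by (subst (asm) prob_eq_1) auto
  then show ?thesis by eventually_elim (auto simp: count_in_of_nat)
qed

lemma measurable_count_in:
  assumes "\<eta> \<in> measurable M (measure_algebra S)" "A \<in> sets S"
  shows "(\<lambda>\<omega>. count_in (\<eta> \<omega>) A) \<in> measurable M (count_space UNIV)"
proof -
  have [measurable]: "(\<lambda>\<omega>. emeasure (\<eta> \<omega>) A) \<in> borel_measurable M"
    using measurable_compose[OF assms(1) measurable_emeasure_measure_algebra[OF assms(2)]] .
  show ?thesis unfolding count_in_def by measurable
qed

lemma poisson_count_pgf:
  assumes "prob_space M" and ppp: "poisson_point_process M \<Lambda> \<eta>"
    and A: "A \<in> sets \<Lambda>" "emeasure \<Lambda> A < \<infinity>" and s: "0 \<le> s" "s \<le> 1"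
  shows "(\<integral>\<omega>. s ^ count_in (\<eta> \<omega>) A \<partial>M) = exp (- (measure \<Lambda> A * (1 - s)))"
proof -
  interpret prob_space M by fact
  have \<eta>: "\<eta> \<in> measurable M (measure_algebra \<Lambda>)" using ppp by (simp add: poisson_point_process_def)
  have [measurable]: "(\<lambda>\<omega>. emeasure (\<eta> \<omega>) A) \<in> borel_measurable M"
    using measurable_compose[OF \<eta> measurable_emeasure_measure_algebra[OF A(1)]] .
  note [measurable] = measurable_count_in[OF \<eta> A(1)]
  show ?thesis
  proof (rule poisson_pgf[OF _ _ s])
    fix k
    have "prob {\<omega> \<in> space M. count_in (\<eta> \<omega>) A = k} = prob {\<omega> \<in> space M. emeasure (\<eta> \<omega>) A = of_nat k}"
    proof (rule finite_measure_eq_AE)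
      show "AE \<omega> in M. \<omega> \<in> {\<omega> \<in> space M. count_in (\<eta> \<omega>) A = k} \<longleftrightarrow>
          \<omega> \<in> {\<omega> \<in> space M. emeasure (\<eta> \<omega>) A = of_nat k}"
        using poisson_count_AE_finite[OF assms(1,2) A]
      proof eventually_elim
        case (elim \<omega>)
        then show ?case by simp
      qed
    qed auto
    then show "prob {\<omega> \<in> space M. count_in (\<eta> \<omega>) A = k} = measure \<Lambda> A ^ k / fact k * exp (- measure \<Lambda> A)"
      using ppp A by (simp add: poisson_point_process_def)
  qed measurable
qed

text \<open>One discretization serves two purposes below: rounding a function to finitely many levels, and
rounding a time to a countable grid.\<close>

lemma floor_approx_tendsto:
  fixes g :: real
  assumes "0 \<le> g"
  shows "(\<lambda>m. real (nat \<lfloor>real (Suc m) * g\<rfloor>) / real (Suc m)) \<longlonglongrightarrow> g"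
proof (rule real_tendsto_sandwich[where f = "\<lambda>m. g - inverse (real (Suc m))" and h = "\<lambda>_. g"])
  have fl: "real (nat \<lfloor>real (Suc m) * g\<rfloor>) = of_int \<lfloor>real (Suc m) * g\<rfloor>" for m
    using assms by (intro of_nat_nat) simp
  show "\<forall>\<^sub>F m in sequentially. g - inverse (real (Suc m)) \<le> real (nat \<lfloor>real (Suc m) * g\<rfloor>) / real (Suc m)"
  proof (intro always_eventually allI)
    fix m
    have "real (Suc m) * g - 1 \<le> of_int \<lfloor>real (Suc m) * g\<rfloor>" by linarith
    then have "(real (Suc m) * g - 1) / real (Suc m) \<le> of_int \<lfloor>real (Suc m) * g\<rfloor> / real (Suc m)"
      by (intro divide_right_mono) auto
    then show "g - inverse (real (Suc m)) \<le> real (nat \<lfloor>real (Suc m) * g\<rfloor>) / real (Suc m)"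
      unfolding fl by (simp add: diff_divide_distrib inverse_eq_divide del: of_nat_Suc)
  qed
  show "\<forall>\<^sub>F m in sequentially. real (nat \<lfloor>real (Suc m) * g\<rfloor>) / real (Suc m) \<le> g"
  proof (intro always_eventually allI)
    fix m
    have "of_int \<lfloor>real (Suc m) * g\<rfloor> \<le> real (Suc m) * g" by linarith
    then show "real (nat \<lfloor>real (Suc m) * g\<rfloor>) / real (Suc m) \<le> g"
      unfolding fl by (simp add: divide_le_eq mult.commute del: of_nat_Suc)
  qed
  show "(\<lambda>m. g - inverse (real (Suc m))) \<longlonglongrightarrow> g"
    using tendsto_diff[OF tendsto_const LIMSEQ_inverse_real_of_nat, of g] by simp
qed simp

text \<open>If \<open>g\<close> takes finitely many values, its product over the points is a product of powers of the counts
on its level sets, which are independent Poisson variables, so the expectation factorizes.  The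
general case follows by rounding \<open>g\<close> down to multiples of \<open>1 / (m + 1)\<close> and dominated
convergence on both sides.  The restriction to a set \<open>D\<close> of finite intensity keeps the product
finite almost surely; the exceptional configurations, where the product over an infinite set is \<open>1\<close> by
convention, must be treated explicitly to obtain measurability everywhere.\<close>

lemma poisson_laplace_functional:
  fixes g :: "'a \<Rightarrow> real" and x :: "'w \<Rightarrow> 'i \<Rightarrow> 'a"
  assumes M: "prob_space M"
    and ppp: "poisson_point_process M \<Lambda> (\<lambda>\<omega>. point_configuration S (I \<omega>) (x \<omega>))"
    and sets_\<Lambda>: "sets \<Lambda> = sets S"
    and x: "\<And>\<omega> i. \<omega> \<in> space M \<Longrightarrow> i \<in> I \<omega> \<Longrightarrow> x \<omega> i \<in> space S"
    and D: "D \<in> sets S" "emeasure \<Lambda> D < \<infinity>"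
    and g[measurable]: "g \<in> borel_measurable S" and g01: "\<And>q. q \<in> space S \<Longrightarrow> 0 \<le> g q \<and> g q \<le> 1"
  shows "(\<lambda>\<omega>. \<Prod>i\<in>{i \<in> I \<omega>. x \<omega> i \<in> D}. g (x \<omega> i)) \<in> borel_measurable M" (is ?meas)
    and "(\<integral>\<omega>. (\<Prod>i\<in>{i \<in> I \<omega>. x \<omega> i \<in> D}. g (x \<omega> i)) \<partial>M) = exp (- (LINT q:D|\<Lambda>. 1 - g q))" (is ?int)
proof -
  interpret prob_space M by fact
  define \<eta> where "\<eta> = (\<lambda>\<omega>. point_configuration S (I \<omega>) (x \<omega>))"
  note ppp' = ppp[folded \<eta>_def]
  note [measurable_cong] = sets_\<Lambda>
  have \<eta>[unfolded measure_algebra_cong[OF sets_\<Lambda>]]: "\<eta> \<in> measurable M (measure_algebra \<Lambda>)"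
    using ppp' by (simp add: poisson_point_process_def)
  have em[measurable]: "(\<lambda>\<omega>. emeasure (\<eta> \<omega>) A) \<in> borel_measurable M" if "A \<in> sets S" for A
    using measurable_compose[OF \<eta> measurable_emeasure_measure_algebra[OF that]] .
  have DS: "D \<subseteq> space S" using D sets.sets_into_space by auto
  define gm where "gm m q = real (nat \<lfloor>real (Suc m) * g q\<rfloor>) / real (Suc m)" for m q
  define A where "A m j = {q \<in> D. nat \<lfloor>real (Suc m) * g q\<rfloor> = j}" for m j
  have A[measurable]: "A m j \<in> sets S" for m j
  proof -
    have "{q \<in> space S. q \<in> D \<and> nat \<lfloor>real (Suc m) * g q\<rfloor> = j} \<in> sets S" using D(1) by measurable
    also have "{q \<in> space S. q \<in> D \<and> nat \<lfloor>real (Suc m) * g q\<rfloor> = j} = A m j"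
      using DS by (auto simp: A_def)
    finally show ?thesis .
  qed
  have A_fin: "emeasure \<Lambda> (A m j) < \<infinity>" for m j
    using D A[of m j] by (intro le_less_trans[OF emeasure_mono D(2)]) (auto simp: A_def sets_\<Lambda>)
  have level: "nat \<lfloor>real (Suc m) * g q\<rfloor> < Suc (Suc m)" if "q \<in> D" for m q
  proof -
    have "real (Suc m) * g q \<le> real (Suc m) * 1" using g01 DS that by (intro mult_left_mono) auto
    from floor_mono[OF this] have "\<lfloor>real (Suc m) * g q\<rfloor> \<le> int (Suc m)"
      by (simp only: mult_1_right floor_of_nat)
    then show ?thesis by linarith
  qed
  have gm01: "0 \<le> gm m q \<and> gm m q \<le> 1" if "q \<in> D" for m q
    using level[OF that, of m] by (simp add: gm_def divide_le_eq)
  have disj: "disjoint_family_on (A m) X" for m X by (auto simp: disjoint_family_on_def A_def)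
  \<comment> \<open>The product of the rounded function over the points, written in terms of counts, with the conventional value where there are infinitely many points.\<close>
  define \<Phi> where "\<Phi> m \<omega> = (if emeasure (\<eta> \<omega>) D = \<infinity> then 1 else
    \<Prod>j<Suc (Suc m). (real j / real (Suc m)) ^ count_in (\<eta> \<omega>) (A m j))" for m \<omega>
  define F where "F \<omega> = {i \<in> I \<omega>. x \<omega> i \<in> D}" for \<omega>
  have F_inf: "emeasure (\<eta> \<omega>) D = \<infinity> \<longleftrightarrow> infinite (F \<omega>)" if "\<omega> \<in> space M" for \<omega>
  proof -
    have "emeasure (\<eta> \<omega>) D = emeasure (count_space (I \<omega>)) (F \<omega>)"
      unfolding \<eta>_def F_def by (rule emeasure_point_configuration[OF x[OF that] D(1)])
    also have "F \<omega> \<subseteq> I \<omega>" by (auto simp: F_def)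
    then have "emeasure (count_space (I \<omega>)) (F \<omega>) = (if finite (F \<omega>) then of_nat (card (F \<omega>)) else \<infinity>)"
      by (rule emeasure_count_space)
    finally show ?thesis by (simp add: ennreal_of_nat_eq_real_of_nat)
  qed
  have \<Phi>_eq: "\<Phi> m \<omega> = (\<Prod>i\<in>F \<omega>. gm m (x \<omega> i))" if \<omega>: "\<omega> \<in> space M" for m \<omega>
  proof (cases "finite (F \<omega>)")
    case False
    then show ?thesis using F_inf[OF \<omega>] by (simp add: \<Phi>_def)
  next
    case True
    let ?l = "\<lambda>i. nat \<lfloor>real (Suc m) * g (x \<omega> i)\<rfloor>"
    have "(\<Prod>i\<in>F \<omega>. gm m (x \<omega> i)) = (\<Prod>j<Suc (Suc m). \<Prod>i\<in>{i \<in> F \<omega>. ?l i = j}. gm m (x \<omega> i))"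
      using True level by (intro prod.group[symmetric]) (auto simp: F_def simp del: of_nat_Suc)
    also have "\<dots> = (\<Prod>j<Suc (Suc m). (real j / real (Suc m)) ^ card {i \<in> F \<omega>. ?l i = j})"
      by (intro prod.cong refl) (simp add: gm_def)
    also have "\<dots> = (\<Prod>j<Suc (Suc m). (real j / real (Suc m)) ^ count_in (\<eta> \<omega>) (A m j))"
    proof (intro prod.cong refl arg_cong2[where f = power] count_in_of_nat[symmetric])
      fix j
      have eq: "{i \<in> I \<omega>. x \<omega> i \<in> A m j} = {i \<in> F \<omega>. ?l i = j}" by (auto simp: A_def F_def)
      show "emeasure (\<eta> \<omega>) (A m j) = of_nat (card {i \<in> F \<omega>. ?l i = j})"
        unfolding \<eta>_def eq[symmetric]
        by (rule emeasure_point_configuration_finite[OF x[OF \<omega>] A]) (simp_all only: eq, use True in simp)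
    qed
    finally show ?thesis using True F_inf[OF \<omega>] by (simp add: \<Phi>_def)
  qed
  have gm_lim: "(\<lambda>m. gm m q) \<longlonglongrightarrow> g q" if "q \<in> D" for q
    unfolding gm_def using floor_approx_tendsto[of "g q"] g01 DS that by blast
  have \<Phi>_lim: "(\<lambda>m. \<Phi> m \<omega>) \<longlonglongrightarrow> (\<Prod>i\<in>F \<omega>. g (x \<omega> i))" if "\<omega> \<in> space M" for \<omega>
    unfolding \<Phi>_eq[OF that] by (intro tendsto_prod gm_lim) (auto simp: F_def)
  note [measurable] = measurable_count_in[OF \<eta> A] em[OF D(1)]
  have \<Phi>_meas[measurable]: "\<Phi> m \<in> borel_measurable M" for m
    unfolding \<Phi>_def by measurable
  show meas: ?meas
    unfolding F_def[symmetric] by (rule borel_measurable_LIMSEQ_real[OF \<Phi>_lim \<Phi>_meas])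
  have \<Phi>_int: "expectation (\<Phi> m) = exp (- (LINT q:D|\<Lambda>. 1 - gm m q))" for m
  proof -
    let ?s = "\<lambda>j. real j / real (Suc m)"
    have "indep_vars (\<lambda>_. borel) (\<lambda>j \<omega>. emeasure (\<eta> \<omega>) (A m j)) {..<Suc (Suc m)}"
      using ppp' disj A unfolding poisson_point_process_def sets_\<Lambda> by blast
    then have "indep_vars (\<lambda>_. borel) (\<lambda>j \<omega>. ?s j ^ nat \<lfloor>enn2real (emeasure (\<eta> \<omega>) (A m j))\<rfloor>) {..<Suc (Suc m)}"
      by (rule indep_vars_compose2[where Y = "\<lambda>j e. ?s j ^ nat \<lfloor>enn2real e\<rfloor>"]) measurable
    then have ind: "indep_vars (\<lambda>_. borel) (\<lambda>j \<omega>. ?s j ^ count_in (\<eta> \<omega>) (A m j)) {..<Suc (Suc m)}"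
      unfolding count_in_def .
    have "expectation (\<Phi> m) = expectation (\<lambda>\<omega>. \<Prod>j<Suc (Suc m). ?s j ^ count_in (\<eta> \<omega>) (A m j))"
    proof (rule integral_cong_AE)
      have "AE \<omega> in M. emeasure (\<eta> \<omega>) D = of_nat (count_in (\<eta> \<omega>) D)"
        by (rule poisson_count_AE_finite[OF M ppp']) (use D in \<open>auto simp: sets_\<Lambda>\<close>)
      then show "AE \<omega> in M. \<Phi> m \<omega> = (\<Prod>j<Suc (Suc m). ?s j ^ count_in (\<eta> \<omega>) (A m j))"
      proof eventually_elim
        case (elim \<omega>)
        then have "emeasure (\<eta> \<omega>) D \<noteq> \<infinity>" by (metis ennreal_of_nat_eq_real_of_nat infinity_ennreal_def ennreal_neq_top)
        then show ?case by (simp add: \<Phi>_def del: prod.lessThan_Suc)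
      qed
    qed measurable
    also have "\<dots> = (\<Prod>j<Suc (Suc m). expectation (\<lambda>\<omega>. ?s j ^ count_in (\<eta> \<omega>) (A m j)))"
    proof (rule indep_vars_lebesgue_integral[OF _ ind])
      fix j assume "j \<in> {..<Suc (Suc m)}"
      then show "integrable M (\<lambda>\<omega>. ?s j ^ count_in (\<eta> \<omega>) (A m j))"
        by (intro integrable_const_bound[where B = 1]) (auto simp: power_le_one divide_le_eq)
    qed simp
    also have "\<dots> = (\<Prod>j<Suc (Suc m). exp (- (measure \<Lambda> (A m j) * (1 - ?s j))))"
      by (intro prod.cong refl poisson_count_pgf[OF M ppp'] A_fin)
        (use A in \<open>auto simp: sets_\<Lambda> divide_le_eq\<close>)
    also have "\<dots> = exp (- (\<Sum>j<Suc (Suc m). measure \<Lambda> (A m j) * (1 - ?s j)))"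
      by (simp add: exp_sum[symmetric] sum_negf del: sum.lessThan_Suc prod.lessThan_Suc)
    also have "(\<Sum>j<Suc (Suc m). measure \<Lambda> (A m j) * (1 - ?s j)) =
        (\<integral>q. (\<Sum>j<Suc (Suc m). indicator (A m j) q * (1 - ?s j)) \<partial>\<Lambda>)"
    proof -
      have "has_bochner_integral \<Lambda> (\<lambda>q. \<Sum>j<Suc (Suc m). indicator (A m j) q * (1 - ?s j))
        (\<Sum>j<Suc (Suc m). measure \<Lambda> (A m j) * (1 - ?s j))"
        by (intro has_bochner_integral_sum has_bochner_integral_mult_left has_bochner_integral_real_indicator)
          (use A A_fin in \<open>auto simp: sets_\<Lambda>\<close>)
      then show ?thesis by (rule has_bochner_integral_integral_eq[symmetric])
    qed
    also have "\<dots> = (LINT q:D|\<Lambda>. 1 - gm m q)"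
      unfolding set_lebesgue_integral_def
    proof (rule Bochner_Integration.integral_cong[OF refl])
      fix q
      have "(\<Sum>j<Suc (Suc m). indicator (A m j) q * (1 - ?s j)) =
        (\<Sum>j<Suc (Suc m). if nat \<lfloor>real (Suc m) * g q\<rfloor> = j then indicator D q * (1 - ?s j) else 0)"
        by (intro sum.cong) (auto simp: A_def split: split_indicator)
      also have "\<dots> = indicator D q * (1 - gm m q)"
        using level[of q m] by (subst sum.delta') (auto simp: gm_def split: split_indicator)
      finally show "(\<Sum>j<Suc (Suc m). indicator (A m j) q * (1 - ?s j)) = indicator D q *\<^sub>R (1 - gm m q)"
        by simp
    qed
    finally show ?thesis .
  qed
  have "(\<lambda>m. expectation (\<Phi> m)) \<longlonglongrightarrow> expectation (\<lambda>\<omega>. \<Prod>i\<in>F \<omega>. g (x \<omega> i))"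
  proof (rule integral_dominated_convergence[where w = "\<lambda>_. 1"])
    show "AE \<omega> in M. norm (\<Phi> m \<omega>) \<le> 1" for m
      using gm01 by (intro AE_I2) (auto simp: \<Phi>_eq abs_prod F_def intro!: prod_le_1)
    show "AE \<omega> in M. (\<lambda>m. \<Phi> m \<omega>) \<longlonglongrightarrow> (\<Prod>i\<in>F \<omega>. g (x \<omega> i))"
      using \<Phi>_lim by (intro AE_I2) auto
  qed (use meas in \<open>auto simp: F_def\<close>)
  moreover have "(\<lambda>m. LINT q:D|\<Lambda>. 1 - gm m q) \<longlonglongrightarrow> (LINT q:D|\<Lambda>. 1 - g q)"
    unfolding set_lebesgue_integral_def
  proof (rule integral_dominated_convergence[where w = "indicator D"])
    show "integrable \<Lambda> (indicator D :: 'a \<Rightarrow> real)" using D by (simp add: sets_\<Lambda>)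
    show "AE q in \<Lambda>. (\<lambda>m. indicator D q *\<^sub>R (1 - gm m q)) \<longlonglongrightarrow> indicator D q *\<^sub>R (1 - g q)"
      by (intro AE_I2) (auto intro!: tendsto_intros gm_lim split: split_indicator)
    show "AE q in \<Lambda>. norm (indicator D q *\<^sub>R (1 - gm m q)) \<le> indicator D q" for m
      using gm01 by (intro AE_I2) (auto split: split_indicator)
    show "(\<lambda>q. indicator D q *\<^sub>R (1 - g q)) \<in> borel_measurable \<Lambda>"
      using D(1) by measurable
    show "(\<lambda>q. indicator D q *\<^sub>R (1 - gm m q)) \<in> borel_measurable \<Lambda>" for m
      unfolding gm_def using D(1) by measurable
  qed
  then have "(\<lambda>m. expectation (\<Phi> m)) \<longlonglongrightarrow> exp (- (LINT q:D|\<Lambda>. 1 - g q))"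
    unfolding \<Phi>_int by (intro tendsto_intros)
  ultimately show ?int
    unfolding F_def using LIMSEQ_unique by blast
qed

section \<open>Point processes with a Poisson Laplace functional\<close>

lemma prod_over_points_eq_prod_powers:
  fixes s :: "'b \<Rightarrow> real"
  assumes "finite I"
  shows "(\<Prod>i\<in>I. \<Prod>a\<in>F. if x i \<in> A a then s a else 1) = (\<Prod>a\<in>F. s a ^ card {i \<in> I. x i \<in> A a})"
  using assms by (subst prod.swap) (simp add: prod.inter_filter[symmetric])

lemma prod_indicator_eq_of_bool:
  "finite F \<Longrightarrow> (\<Prod>a\<in>F. indicator (C a) (g a)) = (of_bool (\<forall>a\<in>F. g a \<in> C a) :: real)"
  by (induction F rule: finite_induct) (auto simp: indicator_def)

text \<open>With \<open>X = 1\<close> and \<open>\<theta> = \<Lambda>\<close> this recognizes a Poisson law; with a weight \<open>X\<close> depending on the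
configuration it extracts the part of an expectation on which the total number of points is \<open>k\<close>.\<close>

lemma (in finite_measure) poisson_coefficients:
  fixes X :: "'a \<Rightarrow> real"
  assumes [measurable]: "X \<in> borel_measurable M" "K \<in> measurable M (count_space UNIV)"
    and X: "\<And>x. x \<in> space M \<Longrightarrow> \<bar>X x\<bar> \<le> 1"
    and pgf: "\<And>s. 0 \<le> s \<Longrightarrow> s \<le> 1 \<Longrightarrow> (\<integral>x. X x * s ^ K x \<partial>M) = exp (\<theta> * s - \<Lambda>)"
  shows "(\<integral>x. X x * indicator {k} (K x) \<partial>M) = \<theta> ^ k / fact k * exp (- \<Lambda>)"
proof -
  have "(\<lambda>k. ((\<integral>x. X x * indicator {k} (K x) \<partial>M) - \<theta> ^ k / fact k * exp (- \<Lambda>)) * s ^ k) sums 0"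
    if s: "0 < s" "s < 1" for s
  proof -
    have "(\<lambda>k. (\<integral>x. X x * indicator {k} (K x) \<partial>M) * s ^ k) sums (\<integral>x. X x * s ^ K x \<partial>M)"
      by (rule integral_nat_valued_sums[where C = 1]) (use s X in \<open>auto simp: power_le_one\<close>)
    moreover have "(\<lambda>k. \<theta> ^ k / fact k * exp (- \<Lambda>) * s ^ k) sums (exp (\<theta> * s) * exp (- \<Lambda>))"
      using sums_mult2[OF exp_converges[of "\<theta> * s"], of "exp (- \<Lambda>)"]
      by (simp add: power_mult_distrib divide_inverse mult_ac scaleR_conv_of_real)
    ultimately show ?thesis
      using sums_diff pgf[of s] s by (fastforce simp: left_diff_distrib exp_add[symmetric])
  qed
  from power_series_coeff_zero[OF this, of k] show ?thesis by simp
qed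

text \<open>A finite random configuration whose Laplace functional is that of a Poisson process with intensity
\<open>c \<mu>\<close>.  The index sets \<open>I \<omega>\<close> are arbitrary finite sets rather than initial segments because
thinning leaves gaps in the enumeration.\<close>

locale poisson_laplace = prob_space M + mu: prob_space \<mu>
  for M :: "'w measure" and \<mu> :: "'a measure" +
  fixes S :: "'a measure" and c :: real and I :: "'w \<Rightarrow> nat set" and x :: "'w \<Rightarrow> nat \<Rightarrow> 'a"
  assumes sets_\<mu>: "sets \<mu> = sets S" and c: "0 < c"
    and finite_I: "\<And>\<omega>. \<omega> \<in> space M \<Longrightarrow> finite (I \<omega>)"
    and points: "\<And>\<omega> i. \<omega> \<in> space M \<Longrightarrow> i \<in> I \<omega> \<Longrightarrow> x \<omega> i \<in> space S"
    and measurable_count: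
      "\<And>A. A \<in> sets S \<Longrightarrow> (\<lambda>\<omega>. card {i \<in> I \<omega>. x \<omega> i \<in> A}) \<in> measurable M (count_space UNIV)"
    and laplace: "\<And>h. h \<in> borel_measurable S \<Longrightarrow> (\<And>q. q \<in> space S \<Longrightarrow> 0 \<le> h q \<and> h q \<le> 1) \<Longrightarrow>
      (\<integral>\<omega>. (\<Prod>i\<in>I \<omega>. h (x \<omega> i)) \<partial>M) = exp (- (c * (\<integral>q. 1 - h q \<partial>\<mu>)))"
begin

abbreviation points_in :: "'a set \<Rightarrow> 'w \<Rightarrow> nat" where
  "points_in A \<omega> \<equiv> card {i \<in> I \<omega>. x \<omega> i \<in> A}"

abbreviation \<eta> :: "'w \<Rightarrow> 'a measure" where
  "\<eta> \<omega> \<equiv> point_configuration S (I \<omega>) (x \<omega>)"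

lemma emeasure_\<eta>: "\<omega> \<in> space M \<Longrightarrow> A \<in> sets S \<Longrightarrow> emeasure (\<eta> \<omega>) A = of_nat (points_in A \<omega>)"
  using finite_I[of \<omega>] points[of \<omega>] by (intro emeasure_point_configuration_finite) auto

lemma measurable_\<eta>: "\<eta> \<in> measurable M (measure_algebra S)"
proof (rule measurable_measure_algebra)
  fix A assume A: "A \<in> sets S"
  have "(\<lambda>\<omega>. of_nat (points_in A \<omega>) :: ennreal) \<in> borel_measurable M"
    by (rule measurable_compose[OF measurable_count[OF A]]) simp
  then show "(\<lambda>\<omega>. emeasure (\<eta> \<omega>) A) \<in> borel_measurable M"
    using emeasure_\<eta>[OF _ A] by (rule measurable_cong[THEN iffD2, rotated])
qed simp

lemma joint_pgf_points_in:
  fixes s :: "'b \<Rightarrow> real"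
  assumes F: "finite F" and A: "\<And>a. a \<in> F \<Longrightarrow> A a \<in> sets S" and s: "\<And>a. a \<in> F \<Longrightarrow> 0 \<le> s a \<and> s a \<le> 1"
  shows "(\<integral>\<omega>. (\<Prod>a\<in>F. s a ^ points_in (A a) \<omega>) \<partial>M) =
    exp (c * (\<integral>q. (\<Prod>a\<in>F. if q \<in> A a then s a else 1) \<partial>\<mu>) - c)"
proof -
  note [measurable_cong] = sets_\<mu>
  let ?h = "\<lambda>q. \<Prod>a\<in>F. if q \<in> A a then s a else 1"
  have h[measurable]: "?h \<in> borel_measurable S" using A by measurable
  have h01: "0 \<le> ?h q" "?h q \<le> 1" for q using s by (auto intro!: prod_nonneg prod_le_1)
  have "(\<integral>\<omega>. (\<Prod>a\<in>F. s a ^ points_in (A a) \<omega>) \<partial>M) = (\<integral>\<omega>. (\<Prod>i\<in>I \<omega>. ?h (x \<omega> i)) \<partial>M)"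
    by (intro Bochner_Integration.integral_cong refl) (simp add: prod_over_points_eq_prod_powers finite_I)
  also have "\<dots> = exp (- (c * (\<integral>q. 1 - ?h q \<partial>\<mu>)))"
    using h01 by (intro laplace h) auto
  also have "(\<integral>q. 1 - ?h q \<partial>\<mu>) = 1 - (\<integral>q. ?h q \<partial>\<mu>)"
    using h01 by (subst Bochner_Integration.integral_diff)
      (auto intro!: mu.integrable_const_bound[where B = 1] simp: mu.prob_space)
  finally show ?thesis by (simp add: algebra_simps)
qed

lemma pgf_points_in:
  assumes A: "A \<in> sets S" and s: "0 \<le> s" "s \<le> 1"
  shows "(\<integral>\<omega>. s ^ points_in A \<omega> \<partial>M) = exp (c * measure \<mu> A * s - c * measure \<mu> A)"
proof -
  note [measurable_cong] = sets_\<mu>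
  have "(\<integral>q. (if q \<in> A then s else 1) \<partial>\<mu>) = (\<integral>q. 1 - (1 - s) * indicator A q \<partial>\<mu>)"
    by (intro Bochner_Integration.integral_cong) (auto split: split_indicator)
  also have "\<dots> = 1 - (1 - s) * measure \<mu> A"
    using A by (subst Bochner_Integration.integral_diff) (auto simp: mu.prob_space sets_\<mu> less_top[symmetric])
  finally have e: "(\<integral>q. (if q \<in> A then s else 1) \<partial>\<mu>) = 1 - (1 - s) * measure \<mu> A" .
  have "(\<integral>\<omega>. s ^ points_in A \<omega> \<partial>M) = exp (c * (1 - (1 - s) * measure \<mu> A) - c)"
    using joint_pgf_points_in[of "{()}" "\<lambda>_. A" "\<lambda>_. s"] A s by (simp add: e)
  then show ?thesis by (simp add: algebra_simps)
qed

lemma prob_points_in: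
  assumes A: "A \<in> sets S"
  shows "prob {\<omega> \<in> space M. points_in A \<omega> = k} = (c * measure \<mu> A) ^ k / fact k * exp (- (c * measure \<mu> A))"
proof -
  note [measurable] = measurable_count[OF A]
  have "(\<integral>\<omega>. (1::real) * indicator {k} (points_in A \<omega>) \<partial>M) = (c * measure \<mu> A) ^ k / fact k * exp (- (c * measure \<mu> A))"
    by (rule poisson_coefficients) (use A pgf_points_in in \<open>auto\<close>)
  also have "(\<integral>\<omega>. (1::real) * indicator {k} (points_in A \<omega>) \<partial>M) =
      (\<integral>\<omega>. indicator {\<omega> \<in> space M. points_in A \<omega> = k} \<omega> \<partial>M)"
    by (intro Bochner_Integration.integral_cong) (auto split: split_indicator)
  finally show ?thesis by simp
qed

text \<open>For disjoint sets at most one factor of \<open>h\<close> differs from \<open>1\<close> at each point, so \<open>1 - h\<close> is a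
sum over the sets and the exponential becomes a product.  This is where the independence of the
counts comes from.\<close>

lemma joint_pgf_disjoint:
  fixes s :: "'b \<Rightarrow> real"
  assumes F: "finite F" and A: "\<And>a. a \<in> F \<Longrightarrow> A a \<in> sets S" and s: "\<And>a. a \<in> F \<Longrightarrow> 0 \<le> s a \<and> s a \<le> 1"
    and disj: "disjoint_family_on A F"
  shows "(\<integral>\<omega>. (\<Prod>a\<in>F. s a ^ points_in (A a) \<omega>) \<partial>M) = (\<Prod>a\<in>F. \<integral>\<omega>. s a ^ points_in (A a) \<omega> \<partial>M)"
proof -
  note [measurable_cong] = sets_\<mu>
  have eq: "(\<Prod>a\<in>F. if q \<in> A a then s a else 1) = 1 - (\<Sum>a\<in>F. (1 - s a) * indicator (A a) q)" for q
  proof (cases "\<exists>a\<in>F. q \<in> A a")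
    case True
    then obtain a where a: "a \<in> F" "q \<in> A a" by auto
    then have other: "q \<notin> A b" if "b \<in> F - {a}" for b
      using disj that by (auto simp: disjoint_family_on_def)
    have "(\<Prod>b\<in>F. if q \<in> A b then s b else 1) = s a"
      using a other F by (subst prod.remove[of F a]) (auto intro!: prod.neutral)
    moreover have "(\<Sum>b\<in>F. (1 - s b) * indicator (A b) q) = 1 - s a"
      using a other F by (subst sum.remove[of F a]) (auto intro!: sum.neutral)
    ultimately show ?thesis by simp
  qed (auto intro!: prod.neutral sum.neutral)
  have "(\<integral>q. (\<Prod>a\<in>F. if q \<in> A a then s a else 1) \<partial>\<mu>) = 1 - (\<Sum>a\<in>F. (1 - s a) * measure \<mu> (A a))"
    unfolding eq using A by (subst Bochner_Integration.integral_diff)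
      (auto simp: mu.prob_space sets_\<mu> less_top[symmetric] Bochner_Integration.integral_sum)
  then have "(\<integral>\<omega>. (\<Prod>a\<in>F. s a ^ points_in (A a) \<omega>) \<partial>M) =
      exp (c * (1 - (\<Sum>a\<in>F. (1 - s a) * measure \<mu> (A a))) - c)"
    using joint_pgf_points_in[OF F A s] by simp
  also have "c * (1 - (\<Sum>a\<in>F. (1 - s a) * measure \<mu> (A a))) - c =
      (\<Sum>a\<in>F. c * measure \<mu> (A a) * s a - c * measure \<mu> (A a))"
    by (simp add: algebra_simps sum_distrib_left sum_subtractf)
  finally show ?thesis
    using A s F by (simp add: exp_sum pgf_points_in)
qed

text \<open>Independence of the counts is expressed by comparing them with independent copies, living on a product
of copies of \<open>M\<close>, by means of the joint generating function.\<close>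

lemma poisson_point_process_\<eta>: "poisson_point_process M (scale_measure (ennreal c) \<mu>) \<eta>"
proof -
  let ?\<Lambda> = "scale_measure (ennreal c) \<mu>"
  have sets[simp]: "sets ?\<Lambda> = sets S" by (simp add: sets_\<mu>)
  have meas: "measure ?\<Lambda> A = c * measure \<mu> A" for A
    using c by (simp add: measure_def enn2real_mult)
  have fin: "emeasure ?\<Lambda> A < \<infinity>" for A
    by (auto simp: ennreal_mult_eq_top_iff less_top[symmetric])
  have law: "prob {\<omega> \<in> space M. emeasure (\<eta> \<omega>) A = of_nat k} =
      measure ?\<Lambda> A ^ k / fact k * exp (- measure ?\<Lambda> A)" if A: "A \<in> sets S" for A k
  proof -
    have "{\<omega> \<in> space M. emeasure (\<eta> \<omega>) A = of_nat k} = {\<omega> \<in> space M. points_in A \<omega> = k}"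
      using emeasure_\<eta>[OF _ A] by auto
    then show ?thesis using prob_points_in[OF A] by (simp add: meas)
  qed
  have indep: "indep_vars (\<lambda>_. borel) (\<lambda>i \<omega>. emeasure (\<eta> \<omega>) (A i)) {..<m}"
    if A: "\<And>i. i < m \<Longrightarrow> A i \<in> sets S" and disj: "disjoint_family_on A {..<m}" for A :: "nat \<Rightarrow> 'a set" and m
    unfolding indep_vars_def2
  proof (intro conjI ballI indep_setsI)
    show rv: "(\<lambda>\<omega>. emeasure (\<eta> \<omega>) (A i)) \<in> borel_measurable M" if "i \<in> {..<m}" for i
      using measurable_compose[OF measurable_\<eta> measurable_emeasure_measure_algebra] A that by auto
    show "{(\<lambda>\<omega>. emeasure (\<eta> \<omega>) (A i)) -` B \<inter> space M |B. B \<in> sets borel} \<subseteq> events" if "i \<in> {..<m}" for i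
      using measurable_sets[OF rv[OF that]] by auto
    fix E and J assume J: "J \<noteq> {}" "J \<subseteq> {..<m}" "finite J"
      and E: "\<forall>j\<in>J. E j \<in> {(\<lambda>\<omega>. emeasure (\<eta> \<omega>) (A j)) -` B \<inter> space M |B. B \<in> sets borel}"
    have AJ: "A j \<in> sets S" if "j \<in> J" for j using A J that by auto
    \<comment> \<open>Counts are natural numbers, so an event about a count is a set of natural numbers.\<close>
    have "\<forall>j\<in>J. \<exists>C. E j = {\<omega> \<in> space M. points_in (A j) \<omega> \<in> C}"
    proof
      fix j assume j: "j \<in> J"
      with E obtain B where "E j = (\<lambda>\<omega>. emeasure (\<eta> \<omega>) (A j)) -` B \<inter> space M" by auto
      then have "E j = {\<omega> \<in> space M. points_in (A j) \<omega> \<in> {k. of_nat k \<in> B}}"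
        using emeasure_\<eta>[OF _ AJ[OF j]] by auto
      then show "\<exists>C. E j = {\<omega> \<in> space M. points_in (A j) \<omega> \<in> C}" by blast
    qed
    from bchoice[OF this] obtain C
      where C: "\<And>j. j \<in> J \<Longrightarrow> E j = {\<omega> \<in> space M. points_in (A j) \<omega> \<in> C j}" by blast
    interpret PJ: product_prob_space "\<lambda>_. M" J by unfold_locales
    have E_sets: "E j \<in> events" if "j \<in> J" for j
      unfolding C[OF that] using measurable_count[OF AJ[OF that]] by measurable
    have int: "integrable M (\<lambda>\<omega>. f (points_in (A j) \<omega>))" if "j \<in> J" "\<And>k. 0 \<le> f k \<and> f k \<le> 1" for f :: "nat \<Rightarrow> real" and j
    proof (rule integrable_const_bound[where B = 1])
      show "(\<lambda>\<omega>. f (points_in (A j) \<omega>)) \<in> borel_measurable M"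
        by (rule measurable_compose[OF measurable_count[OF AJ[OF that(1)]]]) simp
    qed (use that in auto)
    have "(\<integral>\<omega>. (\<Prod>j\<in>J. indicator (C j) (points_in (A j) \<omega>)) \<partial>M) =
        (\<integral>\<omega>. (\<Prod>j\<in>J. (indicator (C j) (points_in (A j) (\<omega> j)) :: real)) \<partial>Pi\<^sub>M J (\<lambda>_. M))"
    proof (rule joint_pgf_unique)
      show "(\<lambda>\<omega>. points_in (A j) (\<omega> j)) \<in> Pi\<^sub>M J (\<lambda>_. M) \<rightarrow>\<^sub>M count_space UNIV" if "j \<in> J" for j
        by (rule measurable_compose[OF measurable_component_singleton[OF that] measurable_count[OF AJ[OF that]]])
      fix s :: "nat \<Rightarrow> real" assume s: "\<And>i. 0 \<le> s i \<and> s i \<le> 1"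
      have "(\<integral>\<omega>. (\<Prod>j\<in>J. s j ^ points_in (A j) \<omega>) \<partial>M) = (\<Prod>j\<in>J. \<integral>\<omega>. s j ^ points_in (A j) \<omega> \<partial>M)"
        using J s AJ disjoint_family_on_mono[OF J(2) disj] by (intro joint_pgf_disjoint) auto
      also have "\<dots> = (\<integral>\<omega>. (\<Prod>j\<in>J. s j ^ points_in (A j) (\<omega> j)) \<partial>Pi\<^sub>M J (\<lambda>_. M))"
        using J s by (intro PJ.product_integral_prod[symmetric] int) (auto simp: power_le_one)
      finally show "(\<integral>\<omega>. (\<Prod>j\<in>J. s j ^ points_in (A j) \<omega>) \<partial>M) =
        (\<integral>\<omega>. (\<Prod>j\<in>J. s j ^ points_in (A j) (\<omega> j)) \<partial>Pi\<^sub>M J (\<lambda>_. M))" .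
    qed (use J AJ measurable_count PJ.finite_measure_axioms finite_measure_axioms in auto)
    also have "\<dots> = (\<Prod>j\<in>J. \<integral>\<omega>. indicator (C j) (points_in (A j) \<omega>) \<partial>M)"
      using J by (intro PJ.product_integral_prod int) auto
    also have "(\<integral>\<omega>. (\<Prod>j\<in>J. (indicator (C j) (points_in (A j) \<omega>) :: real)) \<partial>M) = (\<integral>\<omega>. indicator (\<Inter>j\<in>J. E j) \<omega> \<partial>M)"
    proof (intro Bochner_Integration.integral_cong refl)
      fix \<omega> assume "\<omega> \<in> space M"
      then show "(\<Prod>j\<in>J. indicator (C j) (points_in (A j) \<omega>)) = (indicator (\<Inter>j\<in>J. E j) \<omega> :: real)"
        unfolding prod_indicator_eq_of_bool[OF J(3)] using J(1) by (auto simp: C indicator_def)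
    qed
    also have "\<dots> = prob (\<Inter>j\<in>J. E j)"
      using J E_sets by (auto intro!: sets.finite_INT)
    also have "(\<Prod>j\<in>J. \<integral>\<omega>. indicator (C j) (points_in (A j) \<omega>) \<partial>M) = (\<Prod>j\<in>J. prob (E j))"
    proof (intro prod.cong refl)
      fix j assume j: "j \<in> J"
      have "(\<integral>\<omega>. (indicator (C j) (points_in (A j) \<omega>) :: real) \<partial>M) = (\<integral>\<omega>. indicator (E j) \<omega> \<partial>M)"
        by (intro Bochner_Integration.integral_cong refl) (auto simp: C[OF j] split: split_indicator)
      then show "(\<integral>\<omega>. indicator (C j) (points_in (A j) \<omega>) \<partial>M) = prob (E j)" using E_sets[OF j] by simp
    qed
    finally show "prob (\<Inter>j\<in>J. E j) = (\<Prod>j\<in>J. prob (E j))" .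
  qed
  show ?thesis
    unfolding poisson_point_process_def sets measure_algebra_cong[OF sets]
    using measurable_\<eta> emeasure_\<eta> law indep fin by (auto simp: less_top[symmetric])
qed

lemma measurable_card_points_in_product:
  fixes k :: nat
  assumes "A \<in> sets S"
  shows "(\<lambda>z. card {i \<in> {..<k}. z i \<in> A}) \<in> measurable (Pi\<^sub>M {..<k} (\<lambda>_. \<mu>)) (count_space UNIV)"
proof (rule measurable_card)
  fix i :: nat
  note [measurable_cong] = sets_\<mu>
  show "{z \<in> space (Pi\<^sub>M {..<k} (\<lambda>_. \<mu>)). i \<in> {i \<in> {..<k}. z i \<in> A}} \<in> sets (Pi\<^sub>M {..<k} (\<lambda>_. \<mu>))"
  proof (cases "i < k")
    case True
    then have [measurable]: "(\<lambda>z. z i) \<in> measurable (Pi\<^sub>M {..<k} (\<lambda>_. \<mu>)) S"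
      using measurable_component_singleton[of i "{..<k}" "\<lambda>_. \<mu>"] sets_\<mu> by (auto cong: measurable_cong_sets)
    show ?thesis using assms True by simp
  qed simp
qed

text \<open>Both sides are compared through the joint generating function of finitely many counts.  On the left,
weighting the functional by \<open>t\<close> to the number of points gives
\<open>exp (c t \<integral> h d\<mu> - c)\<close>, whose coefficient of \<open>t\<^sup>k\<close>, divided by the Poisson probability of
\<open>k\<close> points, is \<open>(\<integral> h d\<mu>)\<^sup>k\<close>; on the right this is the expectation of a product over \<open>k\<close>
independent draws.\<close>

lemma conditional_law_\<eta>:
  "distr (uniform_measure M {\<omega> \<in> space M. emeasure (\<eta> \<omega>) (space S) = of_nat k}) (measure_algebra S) \<eta> =
   distr (\<Pi>\<^sub>M i\<in>{..<k}. \<mu>) (measure_algebra S) (\<lambda>z. point_configuration S {..<k} z)"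
proof -
  let ?E = "{\<omega> \<in> space M. points_in (space S) \<omega> = k}"
  define U where "U = uniform_measure M ?E"
  define Y where "Y = (\<Pi>\<^sub>M i\<in>{..<k}. \<mu>)"
  have E_eq: "{\<omega> \<in> space M. emeasure (\<eta> \<omega>) (space S) = of_nat k} = ?E"
    using emeasure_\<eta>[OF _ sets.top] by auto
  note [measurable] = measurable_count[OF sets.top]
  have E[measurable]: "?E \<in> events" by measurable
  have space_\<mu>: "space \<mu> = space S" by (rule sets_eq_imp_space_eq[OF sets_\<mu>])
  have pE: "prob ?E = c ^ k / fact k * exp (- c)"
    using prob_points_in[OF sets.top, of k] by (simp add: space_\<mu>[symmetric] mu.prob_space)
  then have pE_pos: "prob ?E > 0" using c by simp
  interpret U: prob_space U
    unfolding U_def using pE_pos by (intro prob_space_uniform_measure) (auto simp: emeasure_eq_measure)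
  interpret PK: product_prob_space "\<lambda>_. \<mu>" "{..<k}" by unfold_locales
  interpret Y: prob_space Y unfolding Y_def by unfold_locales
  have sets_U[simp]: "sets U = sets M" "space U = space M" by (auto simp: U_def)
  have \<eta>U: "\<eta> \<in> measurable U (measure_algebra S)"
    using measurable_\<eta> by (simp add: measurable_cong_sets[OF sets_U(1) refl])
  let ?pc = "\<lambda>z. point_configuration S {..<k} z"
  have z_space: "z i \<in> space S" if "z \<in> space Y" "i < k" for z i
    using that by (auto simp: Y_def space_PiM space_\<mu>)
  have em_pc: "emeasure (?pc z) A = of_nat (card {i \<in> {..<k}. z i \<in> A})" if "z \<in> space Y" "A \<in> sets S" for z A
    using z_space that by (intro emeasure_point_configuration_finite) auto
  have countY: "(\<lambda>z. card {i \<in> {..<k}. z i \<in> A}) \<in> measurable Y (count_space UNIV)" if "A \<in> sets S" for A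
    unfolding Y_def by (rule measurable_card_points_in_product[OF that])
  have pcY: "?pc \<in> measurable Y (measure_algebra S)"
  proof (rule measurable_measure_algebra)
    fix A assume A: "A \<in> sets S"
    have "(\<lambda>z. of_nat (card {i \<in> {..<k}. z i \<in> A}) :: ennreal) \<in> borel_measurable Y"
      by (rule measurable_compose[OF countY[OF A]]) simp
    then show "(\<lambda>z. emeasure (?pc z) A) \<in> borel_measurable Y"
      by (rule measurable_cong[THEN iffD2, rotated]) (rule em_pc[OF _ A])
  qed simp
  have int_U: "(\<integral>\<omega>. f \<omega> \<partial>U) = (\<integral>\<omega>. f \<omega> * indicator {k} (points_in (space S) \<omega>) \<partial>M) / prob ?E"
    if f[measurable]: "f \<in> borel_measurable M" for f :: "'w \<Rightarrow> real"
  proof -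
    have "1 / ennreal (prob ?E) = ennreal (1 / prob ?E)"
      using divide_ennreal[of 1 "prob ?E"] pE_pos by simp
    then have "U = density M (\<lambda>\<omega>. ennreal (indicator ?E \<omega> / prob ?E))"
      unfolding U_def uniform_measure_def using pE_pos
      by (intro density_cong) (auto simp: emeasure_eq_measure split: split_indicator)
    then have "(\<integral>\<omega>. f \<omega> \<partial>U) = (\<integral>\<omega>. (indicator ?E \<omega> / prob ?E) *\<^sub>R f \<omega> \<partial>M)"
      by (simp add: integral_density)
    also have "\<dots> = (\<integral>\<omega>. f \<omega> * indicator {k} (points_in (space S) \<omega>) / prob ?E \<partial>M)"
      by (intro Bochner_Integration.integral_cong refl) (auto split: split_indicator)
    finally show ?thesis by simp
  qed
  have pgf_eq: "(\<integral>\<omega>. (\<Prod>a\<in>F. s a ^ points_in (A a) \<omega>) \<partial>U) =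
      (\<integral>z. (\<Prod>a\<in>F. s a ^ card {i \<in> {..<k}. z i \<in> A a}) \<partial>Y)"
    if F: "finite F" and A: "\<And>a. a \<in> F \<Longrightarrow> A a \<in> sets S" and s: "\<And>a. 0 \<le> s a \<and> s a \<le> 1"
    for F and s :: "'a set \<times> ennreal set \<Rightarrow> real" and A
  proof -
    note [measurable_cong] = sets_\<mu>
    define X where "X \<omega> = (\<Prod>a\<in>F. s a ^ points_in (A a) \<omega>)" for \<omega>
    define h where "h q = (\<Prod>a\<in>F. if q \<in> A a then s a else 1)" for q
    have X[measurable]: "X \<in> borel_measurable M"
      unfolding X_def by (intro borel_measurable_prod measurable_compose[OF measurable_count[OF A]]) auto
    have X1: "\<bar>X \<omega>\<bar> \<le> 1" for \<omega>
      using s by (auto simp: X_def abs_prod power_le_one intro!: prod_le_1)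
    have h[measurable]: "h \<in> borel_measurable S" unfolding h_def using A by measurable
    have h01: "0 \<le> h q \<and> h q \<le> 1" for q unfolding h_def using s by (auto intro!: prod_nonneg prod_le_1)
    have "(\<integral>\<omega>. X \<omega> * indicator {k} (points_in (space S) \<omega>) \<partial>M) = (c * (\<integral>q. h q \<partial>\<mu>)) ^ k / fact k * exp (- c)"
    proof (rule poisson_coefficients)
      fix t :: real assume t: "0 \<le> t" "t \<le> 1"
      let ?h = "\<lambda>q. t * h q"
      have "(\<integral>\<omega>. X \<omega> * t ^ points_in (space S) \<omega> \<partial>M) = (\<integral>\<omega>. (\<Prod>i\<in>I \<omega>. ?h (x \<omega> i)) \<partial>M)"
      proof (intro Bochner_Integration.integral_cong refl)
        fix \<omega> assume \<omega>: "\<omega> \<in> space M"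
        have "{i \<in> I \<omega>. x \<omega> i \<in> space S} = I \<omega>" using points[OF \<omega>] by auto
        then show "X \<omega> * t ^ points_in (space S) \<omega> = (\<Prod>i\<in>I \<omega>. ?h (x \<omega> i))"
          by (simp add: X_def h_def prod.distrib prod_over_points_eq_prod_powers finite_I[OF \<omega>] mult.commute)
      qed
      also have "\<dots> = exp (- (c * (\<integral>q. 1 - ?h q \<partial>\<mu>)))"
        using t h01 by (intro laplace) (auto intro: mult_le_one)
      also have "(\<integral>q. 1 - ?h q \<partial>\<mu>) = 1 - t * (\<integral>q. h q \<partial>\<mu>)"
        using h01 by (subst Bochner_Integration.integral_diff)
          (auto intro!: mu.integrable_const_bound[where B = 1] integrable_mult_right simp: mu.prob_space)
      finally show "(\<integral>\<omega>. X \<omega> * t ^ points_in (space S) \<omega> \<partial>M) = exp (c * (\<integral>q. h q \<partial>\<mu>) * t - c)"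
        by (simp add: algebra_simps)
    qed (use X1 in auto)
    then have "(\<integral>\<omega>. X \<omega> \<partial>U) = (\<integral>q. h q \<partial>\<mu>) ^ k"
      unfolding int_U[OF X] pE using c by (simp add: power_mult_distrib)
    also have "\<dots> = (\<integral>z. (\<Prod>i<k. h (z i)) \<partial>Y)"
      unfolding Y_def using h01
      by (subst PK.product_integral_prod) (auto intro!: mu.integrable_const_bound[where B = 1])
    also have "\<dots> = (\<integral>z. (\<Prod>a\<in>F. s a ^ card {i \<in> {..<k}. z i \<in> A a}) \<partial>Y)"
      unfolding h_def by (subst prod_over_points_eq_prod_powers) auto
    finally show ?thesis unfolding X_def .
  qed
  have "distr U (measure_algebra S) \<eta> = distr Y (measure_algebra S) ?pc"
  proof (rule measure_eqI_measure_algebra)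
    show "finite_measure (distr U (measure_algebra S) \<eta>)"
      using U.prob_space_distr[OF \<eta>U] by (simp add: prob_space_def)
    fix F :: "('a set \<times> ennreal set) set" assume F: "finite F" "F \<subseteq> sets S \<times> sets borel"
    let ?G = "{N. sets N = sets S \<and> (\<forall>(A, B)\<in>F. emeasure N A \<in> B)}"
    let ?f = "\<lambda>a. indicator {n. (of_nat n :: ennreal) \<in> snd a} :: nat \<Rightarrow> real"
    have FA: "fst a \<in> sets S" "snd a \<in> sets borel" if "a \<in> F" for a using F that by auto
    have G: "?G \<in> sets (measure_algebra S)"
    proof -
      have "?G = {N \<in> space (measure_algebra S). \<forall>a\<in>F. emeasure N (fst a) \<in> snd a}"
        by (auto simp: space_measure_algebra)
      also have "\<dots> \<in> sets (measure_algebra S)"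
      proof (rule sets.sets_Collect_finite_All)
        fix a assume "a \<in> F"
        note [measurable] = measurable_emeasure_measure_algebra[OF FA(1)[OF this]] FA(2)[OF this]
        show "{N \<in> space (measure_algebra S). emeasure N (fst a) \<in> snd a} \<in> sets (measure_algebra S)"
          by measurable
      qed (use F in simp)
      finally show ?thesis .
    qed
    have law: "measure (distr V (measure_algebra S) \<xi>) ?G = (\<integral>v. (\<Prod>a\<in>F. ?f a (n (fst a) v)) \<partial>V)"
      if V: "prob_space V" and \<xi>: "\<xi> \<in> measurable V (measure_algebra S)"
        and n: "\<And>v A. v \<in> space V \<Longrightarrow> A \<in> sets S \<Longrightarrow> emeasure (\<xi> v) A = of_nat (n A v)"
      for V :: "'z measure" and \<xi> n
    proof -
      interpret V: prob_space V by fact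
      have "measure (distr V (measure_algebra S) \<xi>) ?G = measure V (\<xi> -` ?G \<inter> space V)"
        by (rule measure_distr[OF \<xi> G])
      also have "\<dots> = (\<integral>v. indicator (\<xi> -` ?G \<inter> space V) v \<partial>V)"
        using measurable_sets[OF \<xi> G] by simp
      also have "\<dots> = (\<integral>v. (\<Prod>a\<in>F. ?f a (n (fst a) v)) \<partial>V)"
      proof (intro Bochner_Integration.integral_cong refl)
        fix v assume v: "v \<in> space V"
        have "sets (\<xi> v) = sets S" using measurable_space[OF \<xi> v] by (simp add: space_measure_algebra)
        then have "v \<in> \<xi> -` ?G \<inter> space V \<longleftrightarrow> (\<forall>a\<in>F. of_nat (n (fst a) v) \<in> snd a)"
          using v n[OF v FA(1)] by auto
        then show "indicator (\<xi> -` ?G \<inter> space V) v = (\<Prod>a\<in>F. ?f a (n (fst a) v))"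
          unfolding prod_indicator_eq_of_bool[OF F(1)] by (simp add: indicator_def)
      qed
      finally show ?thesis .
    qed
    have "measure (distr U (measure_algebra S) \<eta>) ?G = (\<integral>\<omega>. (\<Prod>a\<in>F. ?f a (points_in (fst a) \<omega>)) \<partial>U)"
      by (rule law[OF U.prob_space_axioms \<eta>U]) (simp add: emeasure_\<eta>)
    also have "\<dots> = (\<integral>z. (\<Prod>a\<in>F. ?f a (card {i \<in> {..<k}. z i \<in> fst a})) \<partial>Y)"
    proof (rule joint_pgf_unique)
      show "(\<lambda>\<omega>. points_in (fst a) \<omega>) \<in> measurable U (count_space UNIV)" if "a \<in> F" for a
        using measurable_count[OF FA(1)[OF that]] by (simp add: measurable_cong_sets[OF sets_U(1) refl])
      show "(\<lambda>z. card {i \<in> {..<k}. z i \<in> fst a}) \<in> measurable Y (count_space UNIV)" if "a \<in> F" for a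
        by (rule countY[OF FA(1)[OF that]])
      show "(\<integral>\<omega>. (\<Prod>a\<in>F. s a ^ points_in (fst a) \<omega>) \<partial>U) =
          (\<integral>z. (\<Prod>a\<in>F. s a ^ card {i \<in> {..<k}. z i \<in> fst a}) \<partial>Y)"
        if "\<And>a. 0 \<le> s a \<and> s a \<le> 1" for s :: "'a set \<times> ennreal set \<Rightarrow> real"
        by (rule pgf_eq[OF F(1) FA(1) that])
    qed (fact U.finite_measure_axioms Y.finite_measure_axioms F(1) | simp)+
    also have "\<dots> = measure (distr Y (measure_algebra S) ?pc) ?G"
      by (rule law[OF Y.prob_space_axioms pcY, of "\<lambda>A z. card {i \<in> {..<k}. z i \<in> A}", symmetric])
        (rule em_pc)
    finally have "measure (distr U (measure_algebra S) \<eta>) ?G = measure (distr Y (measure_algebra S) ?pc) ?G" .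
    then show "emeasure (distr U (measure_algebra S) \<eta>) ?G = emeasure (distr Y (measure_algebra S) ?pc) ?G"
      using U.prob_space_distr[OF \<eta>U] Y.prob_space_distr[OF pcY]
      by (simp add: finite_measure.emeasure_eq_measure prob_space_def)
  qed auto
  then show ?thesis unfolding U_def Y_def E_eq .
qed

end

section \<open>Lazy Bernoulli marks\<close>

lemma sets_unit_uniform [measurable_cong, simp]: "sets unit_uniform = sets borel"
  and space_unit_uniform [simp]: "space unit_uniform = UNIV"
  by (simp_all add: unit_uniform_def)

lemma prob_space_unit_uniform: "prob_space unit_uniform"
  unfolding unit_uniform_def by (rule prob_space_uniform_measure) auto

lemma emeasure_unit_uniform_less:
  assumes "0 \<le> c" "c \<le> 1"
  shows "emeasure unit_uniform {v. v < c} = ennreal c"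
proof -
  have "{0<..<1} \<inter> {v. v < c} = {0<..<c}" using assms by auto
  then show ?thesis using assms by (simp add: unit_uniform_def divide_ennreal_def)
qed

lemma emeasure_unit_uniform_not_less:
  assumes "0 \<le> c" "c \<le> 1"
  shows "emeasure unit_uniform {v. \<not> v < c} = ennreal (1 - c)"
proof -
  interpret prob_space unit_uniform by (rule prob_space_unit_uniform)
  have "prob {v. v < c} = c" using emeasure_unit_uniform_less[OF assms] assms by (simp add: measure_def)
  moreover have "prob (space unit_uniform - {v. v < c}) = 1 - prob {v. v < c}" by (rule prob_compl) simp
  moreover have "space unit_uniform - {v. v < c} = {v. \<not> v < c}" by auto
  ultimately show ?thesis by (simp add: emeasure_eq_measure)
qed

lemma space_coefficient_space: "space coefficient_space = {\<xi>. \<forall>l. -1 \<le> \<xi> l \<and> \<xi> l \<le> 1}"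
  by (auto simp: coefficient_space_def space_PiM space_restrict_space)

lemma measurable_coefficient: "(\<lambda>\<xi>. \<xi> l) \<in> borel_measurable coefficient_space"
proof -
  have "(\<lambda>\<xi>. \<xi> l) \<in> measurable coefficient_space (restrict_space borel {-1..1})"
    unfolding coefficient_space_def by measurable
  then show ?thesis by (simp add: measurable_restrict_space2_iff)
qed

locale field_series =
  fixes b :: real and w :: "nat \<Rightarrow> real" and \<phi> :: "nat \<Rightarrow> torus \<Rightarrow> real"
  assumes \<phi>_meas: "\<And>l. \<phi> l \<in> borel_measurable torus_borel"
    and \<phi>_le: "\<And>l x. \<bar>\<phi> l x\<bar> \<le> 1"
    and w_summable: "summable (\<lambda>l. \<bar>w l\<bar>)"
    and w_less: "(\<Sum>l. \<bar>w l\<bar>) < min b (1 - b)"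
begin

abbreviation f :: "(nat \<Rightarrow> real) \<Rightarrow> torus \<Rightarrow> real" where "f \<equiv> series_field b w \<phi>"

lemma term_le: "\<xi> \<in> space coefficient_space \<Longrightarrow> \<bar>w l * \<xi> l * \<phi> l x\<bar> \<le> \<bar>w l\<bar>"
  using mult_mono[of "\<bar>\<xi> l\<bar>" 1 "\<bar>\<phi> l x\<bar>" 1] \<phi>_le[of l x]
  by (auto simp: space_coefficient_space abs_mult mult.assoc abs_le_iff intro!: mult_left_le)

lemma summable_terms: "\<xi> \<in> space coefficient_space \<Longrightarrow> summable (\<lambda>l. w l * \<xi> l * \<phi> l x)"
  by (rule summable_comparison_test'[OF w_summable]) (use term_le in simp)

lemma partial_field_error:
  assumes \<xi>: "\<xi> \<in> space coefficient_space"
  shows "\<bar>f \<xi> x - partial_field b w \<phi> \<xi> x r\<bar> \<le> tail_bound w r"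
proof -
  have "f \<xi> x - partial_field b w \<phi> \<xi> x r = (\<Sum>l. w (l + r) * \<xi> (l + r) * \<phi> (l + r) x)"
    unfolding series_field_def partial_field_def
    using suminf_split_initial_segment[OF summable_terms[OF \<xi>], of x r] by simp
  also have "\<bar>\<dots>\<bar> \<le> (\<Sum>l. \<bar>w (l + r)\<bar>)"
    using norm_suminf_le[of "\<lambda>l. w (l + r) * \<xi> (l + r) * \<phi> (l + r) x" "\<lambda>l. \<bar>w (l + r)\<bar>"]
      term_le[OF \<xi>] summable_ignore_initial_segment[OF w_summable] by simp
  finally show ?thesis by (simp add: tail_bound_def)
qed

lemma tail_bound_tendsto_0: "tail_bound w \<longlonglongrightarrow> 0"
  unfolding tail_bound_def using suminf_exist_split2[OF w_summable] .

lemma f_bounds: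
  assumes "\<xi> \<in> space coefficient_space"
  shows "0 < f \<xi> x" "f \<xi> x < 1"
  using partial_field_error[OF assms, of x 0] w_less
  by (auto simp: partial_field_def tail_bound_def abs_le_iff)

text \<open>The intervals with centre \<open>partial_field\<close> and radius \<open>tail_bound\<close> contain the field value and shrink to it, so below the
field value the first decisive comparison exists and can only be the lower one.\<close>

lemma lazy_mark_iff:
  assumes \<xi>: "\<xi> \<in> space coefficient_space"
  shows "lazy_mark b w \<phi> \<xi> x u \<longleftrightarrow> u < f \<xi> x"
proof
  assume "lazy_mark b w \<phi> \<xi> x u"
  then obtain r where "u < partial_field b w \<phi> \<xi> x r - tail_bound w r" by (auto simp: lazy_mark_def)
  then show "u < f \<xi> x" using partial_field_error[OF \<xi>, of x r] by (auto simp: abs_le_iff)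
next
  assume u: "u < f \<xi> x"
  let ?lower = "\<lambda>r. partial_field b w \<phi> \<xi> x r - tail_bound w r"
  have "(\<lambda>r. partial_field b w \<phi> \<xi> x r) \<longlonglongrightarrow> f \<xi> x"
    unfolding partial_field_def series_field_def
    using summable_LIMSEQ[OF summable_terms[OF \<xi>, of x]] by (intro tendsto_intros)
  then have "?lower \<longlonglongrightarrow> f \<xi> x"
    using tendsto_diff[OF _ tail_bound_tendsto_0] by fastforce
  then have "\<exists>r. u < ?lower r"
    using eventually_happens'[OF sequentially_bot order_tendstoD(1)[OF _ u]] by blast
  then have "u < ?lower (LEAST r. u < ?lower r)" by (rule LeastI_ex)
  moreover have "\<not> u > partial_field b w \<phi> \<xi> x r + tail_bound w r" for r
    using partial_field_error[OF \<xi>, of x r] u by (auto simp: abs_le_iff)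
  ultimately show "lazy_mark b w \<phi> \<xi> x u"
    unfolding lazy_mark_def using not_less_Least by blast
qed

lemma measurable_f:
  "(\<lambda>z. f (fst z) (snd z)) \<in> borel_measurable (coefficient_space \<Otimes>\<^sub>M torus_borel)"
proof -
  note [measurable] = \<phi>_meas measurable_coefficient
  show ?thesis unfolding series_field_def by measurable
qed

end

section \<open>Brownian paths on the torus\<close>

lemma measurable_torus_proj: "torus_proj \<in> measurable borel torus_borel"
  unfolding torus_borel_def by (rule measurable_measure_of) auto

lemma torus_translate_proj: "torus_translate (torus_proj x) v = torus_proj (x + v)"
  by transfer (simp add: torus_rel_def)

lemma torus_proj_surj: "\<exists>x. s = torus_proj x"
  by transfer (metis equivp_reflp equivp_torus_rel)

text \<open>Continuity of the paths makes the process a pointwise limit of its values on countable time grids,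
which are jointly measurable.  Truncating the time at \<open>0\<close> avoids negative times, where the process is
unconstrained.\<close>

lemma continuous_process_measurable:
  fixes W :: "real \<Rightarrow> 'p \<Rightarrow> real \<times> real"
  assumes W: "\<And>t. 0 \<le> t \<Longrightarrow> W t \<in> borel_measurable P"
    and cont: "\<And>p. p \<in> space P \<Longrightarrow> continuous_on {0..} (\<lambda>t. W t p)"
  shows "(\<lambda>z. W (max 0 (fst z)) (snd z)) \<in> borel_measurable (borel \<Otimes>\<^sub>M P)"
proof -
  let ?a = "\<lambda>m t. nat \<lfloor>real (Suc m) * max 0 t\<rfloor>"
  have "(\<lambda>z. W (real (?a m (fst z)) / real (Suc m)) (snd z)) \<in> borel_measurable (borel \<Otimes>\<^sub>M P)" for m
  proof (rule measurable_compose_countable[where f = "\<lambda>j z. W (real j / real (Suc m)) (snd z)"])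
    show "(\<lambda>z. W (real j / real (Suc m)) (snd z)) \<in> borel_measurable (borel \<Otimes>\<^sub>M P)" for j
      by (rule measurable_compose[OF measurable_snd W]) simp
  qed measurable
  moreover have "(\<lambda>m. W (real (?a m (fst z)) / real (Suc m)) (snd z)) \<longlonglongrightarrow> W (max 0 (fst z)) (snd z)"
    if "z \<in> space (borel \<Otimes>\<^sub>M P)" for z
  proof (rule continuous_on_tendsto_compose[OF cont])
    show "snd z \<in> space P" using that by (auto simp: space_pair_measure)
    show "(\<lambda>m. real (?a m (fst z)) / real (Suc m)) \<longlonglongrightarrow> max 0 (fst z)"
      by (rule floor_approx_tendsto) simp
  qed auto
  ultimately show ?thesis by (rule borel_measurable_LIMSEQ_metric)
qed

lemma measurable_torus_path:
  assumes "planar_brownian_motion P W"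
  shows "(\<lambda>z. torus_path W s (max 0 (fst z)) (snd z)) \<in> measurable (borel \<Otimes>\<^sub>M P) torus_borel"
proof -
  obtain x where s: "s = torus_proj x" using torus_proj_surj by blast
  have [measurable]: "(\<lambda>z. W (max 0 (fst z)) (snd z)) \<in> borel_measurable (borel \<Otimes>\<^sub>M P)"
    using assms by (intro continuous_process_measurable) (auto simp: planar_brownian_motion_def)
  note [measurable] = measurable_torus_proj
  show ?thesis unfolding torus_path_def s torus_translate_proj by measurable
qed

section \<open>Poisson-killing forward coins\<close>

locale forward_model = field_series b w \<phi>
  for b :: real and w :: "nat \<Rightarrow> real" and \<phi> :: "nat \<Rightarrow> torus \<Rightarrow> real" +
  fixes lam qmax :: real and P :: "'p measure" and W :: "real \<Rightarrow> 'p \<Rightarrow> real \<times> real"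
    and H :: "'h measure" and \<tau> :: "nat \<Rightarrow> 'h \<Rightarrow> real"
  assumes lam: "0 < lam" and qmax: "0 < qmax"
    and W: "planar_brownian_motion P W" and \<tau>: "homogeneous_poisson_process H qmax \<tau>"
begin

abbreviation T_law :: "real measure" where "T_law \<equiv> density lborel (exponential_density lam)"
abbreviation mark_law :: "(nat \<Rightarrow> real) measure" where "mark_law \<equiv> \<Pi>\<^sub>M k\<in>UNIV. unit_uniform"
abbreviation F :: "('h, 'p) forward_seed measure" where "F \<equiv> forward_seed_space lam H P"
abbreviation coin :: "(nat \<Rightarrow> real) \<Rightarrow> torus \<Rightarrow> ('h, 'p) forward_seed \<Rightarrow> bool" where
  "coin \<equiv> forward_coin b w \<phi> \<tau> W"

sublocale T: prob_space T_law by (rule prob_space_exponential_density[OF lam])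
sublocale P: prob_space P using W by (simp add: planar_brownian_motion_def)
sublocale H: prob_space H using \<tau> by (simp add: homogeneous_poisson_process_def)
sublocale marks: product_prob_space "\<lambda>_. unit_uniform" "UNIV :: nat set"
  using prob_space_unit_uniform
  by (auto intro!: product_prob_space.intro product_sigma_finite.intro prob_space_imp_sigma_finite
    simp: product_prob_space_axioms_def)
sublocale marks: prob_space mark_law by (rule marks.P.prob_space_axioms)

lemma prob_space_F: "prob_space F"
  unfolding forward_seed_space_def
  by (intro prob_space_pair T.prob_space_axioms H.prob_space_axioms P.prob_space_axioms marks.prob_space_axioms)

lemma coin_iff:
  assumes "\<xi> \<in> space coefficient_space"
  shows "coin \<xi> s (t, h, p, u) \<longleftrightarrow>
    (\<forall>k. 0 \<le> \<tau> k h \<and> \<tau> k h \<le> t \<longrightarrow> \<not> u k < f \<xi> (torus_path W s (max 0 (\<tau> k h)) p))"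
  by (auto simp: forward_coin_def lazy_mark_iff[OF assms] max_def)

lemma measurable_\<tau> [measurable]: "\<tau> k \<in> borel_measurable H"
  using \<tau> by (simp add: homogeneous_poisson_process_def)

lemma measurable_coin:
  "Measurable.pred (coefficient_space \<Otimes>\<^sub>M F) (\<lambda>z. coin (fst z) s (snd z))"
proof -
  let ?S = "coefficient_space \<Otimes>\<^sub>M F"
  have [measurable]: "(\<lambda>z. \<tau> k (fst (snd (snd z)))) \<in> borel_measurable ?S"
    "(\<lambda>z. fst (snd z)) \<in> borel_measurable ?S" for k
    unfolding forward_seed_space_def by measurable
  have [measurable]: "(\<lambda>z. snd (snd (snd (snd z))) k) \<in> borel_measurable ?S" for k
  proof -
    have "(\<lambda>u. u k) \<in> borel_measurable mark_law"
      using measurable_component_singleton[of k UNIV "\<lambda>_. unit_uniform"] by simp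
    then show ?thesis
      unfolding forward_seed_space_def by measurable
  qed
  have [measurable]: "(\<lambda>z. torus_path W s (max 0 (\<tau> k (fst (snd (snd z))))) (fst (snd (snd (snd z)))))
      \<in> measurable ?S torus_borel" for k
    unfolding forward_seed_space_def
    by (rule measurable_compose[OF _ measurable_torus_path[OF W, of s],
        where f = "\<lambda>z. (\<tau> k (fst (snd (snd z))), fst (snd (snd (snd z))))", simplified]) measurable
  have [measurable]: "(\<lambda>z. f (fst z) (torus_path W s (max 0 (\<tau> k (fst (snd (snd z))))) (fst (snd (snd (snd z))))))
      \<in> borel_measurable ?S" for k
    by (rule measurable_compose[OF _ measurable_f,
        where f = "\<lambda>z. (fst z, torus_path W s (max 0 (\<tau> k (fst (snd (snd z))))) (fst (snd (snd (snd z)))))", simplified])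
      measurable
  have "Measurable.pred ?S (\<lambda>z. \<forall>k. 0 \<le> \<tau> k (fst (snd (snd z))) \<and> \<tau> k (fst (snd (snd z))) \<le> fst (snd z) \<longrightarrow>
    \<not> snd (snd (snd (snd z))) k < f (fst z) (torus_path W s (max 0 (\<tau> k (fst (snd (snd z))))) (fst (snd (snd (snd z))))))"
    by measurable
  moreover have "coin (fst z) s (snd z) \<longleftrightarrow> (\<forall>k. 0 \<le> \<tau> k (fst (snd (snd z))) \<and> \<tau> k (fst (snd (snd z))) \<le> fst (snd z) \<longrightarrow>
    \<not> snd (snd (snd (snd z))) k < f (fst z) (torus_path W s (max 0 (\<tau> k (fst (snd (snd z))))) (fst (snd (snd (snd z))))))"
    if "z \<in> space ?S" for z
    using that coin_iff[of "fst z" s "fst (snd z)" "fst (snd (snd z))" "fst (snd (snd (snd z)))" "snd (snd (snd (snd z)))"]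
    by (auto simp: space_pair_measure)
  ultimately show ?thesis by (subst measurable_cong) auto
qed

text \<open>With the event times and the path fixed and only finitely many events before \<open>t\<close>, the marks are
independent and each fails with probability \<open>1 - f\<close>.\<close>

lemma nn_integral_over_marks:
  assumes \<xi>: "\<xi> \<in> space coefficient_space" and fin: "finite {k. \<tau> k h \<in> {0..t}}"
  shows "(\<integral>\<^sup>+ u. indicator {z \<in> space F. coin \<xi> s z} (t, h, p, u) \<partial>mark_law) =
    indicator (space H \<times> space P) (h, p) *
      ennreal (\<Prod>k\<in>{k. \<tau> k h \<in> {0..t}}. 1 - f \<xi> (torus_path W s (max 0 (\<tau> k h)) p))"
proof -
  let ?K = "{k. \<tau> k h \<in> {0..t}}" and ?c = "\<lambda>k. f \<xi> (torus_path W s (max 0 (\<tau> k h)) p)"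
  let ?A = "{u \<in> space mark_law. \<forall>k\<in>?K. u k \<in> {v. \<not> v < ?c k}}"
  have A: "?A \<in> sets mark_law"
    using fin by (intro sets.sets_Collect_finite_All) auto
  have "(\<integral>\<^sup>+ u. indicator {z \<in> space F. coin \<xi> s z} (t, h, p, u) \<partial>mark_law) =
      (\<integral>\<^sup>+ u. indicator (space H \<times> space P) (h, p) * indicator ?A u \<partial>mark_law)"
    by (intro nn_integral_cong)
      (auto simp: coin_iff[OF \<xi>] forward_seed_space_def space_pair_measure split: split_indicator)
  also have "\<dots> = indicator (space H \<times> space P) (h, p) * emeasure mark_law ?A"
    using A by (simp add: nn_integral_cmult)
  also have "emeasure mark_law ?A = (\<Prod>k\<in>?K. emeasure unit_uniform {v. \<not> v < ?c k})"
    using fin by (intro marks.emeasure_PiM_Collect) auto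
  also have "\<dots> = (\<Prod>k\<in>?K. ennreal (1 - ?c k))"
    using f_bounds[OF \<xi>] by (intro prod.cong refl emeasure_unit_uniform_not_less) (auto intro: less_imp_le)
  also have "\<dots> = ennreal (\<Prod>k\<in>?K. 1 - ?c k)"
    using f_bounds[OF \<xi>] by (intro prod_ennreal) (auto intro: less_imp_le)
  finally show ?thesis .
qed

lemma events_intensity_finite:
  fixes t :: real
  shows "emeasure (density lborel (\<lambda>v. ennreal (qmax * indicator {0..} v))) {0..t} < \<infinity>"
proof -
  have "emeasure (density lborel (\<lambda>v. ennreal (qmax * indicator {0..} v))) {0..t} =
      (\<integral>\<^sup>+ v. ennreal qmax * indicator {0..t} v \<partial>lborel)"
    by (subst emeasure_density) (auto intro!: nn_integral_cong split: split_indicator)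
  also have "\<dots> = ennreal qmax * emeasure lborel {0..t}" by (simp add: nn_integral_cmult)
  also have "\<dots> < \<infinity>" by (cases "0 \<le> t") (auto simp: ennreal_mult_less_top)
  finally show ?thesis .
qed

text \<open>For a fixed path, averaging the probability that all marks fail over the event times is the
Laplace functional of the homogeneous Poisson process at \<open>1 - f\<close> along the path; the rate
\<open>qmax\<close> turns \<open>f\<close> into the reaction field.\<close>

lemma laplace_over_event_times:
  assumes \<xi>: "\<xi> \<in> space coefficient_space" and p: "p \<in> space P"
  shows "(\<integral>\<^sup>+ h. ennreal (\<Prod>k\<in>{k. \<tau> k h \<in> {0..t}}. 1 - f \<xi> (torus_path W s (max 0 (\<tau> k h)) p)) \<partial>H) =
    ennreal (exp (- (LINT v:{0..t}|lborel. reaction_field qmax b w \<phi> \<xi> (torus_path W s v p))))"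
proof -
  let ?\<Lambda> = "density lborel (\<lambda>v. ennreal (qmax * indicator {0..} v))"
  let ?g = "\<lambda>v. 1 - f \<xi> (torus_path W s (max 0 v) p)"
  have [measurable]: "(\<lambda>v. f \<xi> (torus_path W s (max 0 v) p)) \<in> borel_measurable borel"
  proof -
    have "(\<lambda>v. torus_path W s (max 0 v) p) \<in> measurable borel torus_borel"
      using measurable_compose[OF measurable_Pair2'[OF p] measurable_torus_path[OF W, of s]] by simp
    then have "(\<lambda>v. (\<xi>, torus_path W s (max 0 v) p)) \<in> measurable borel (coefficient_space \<Otimes>\<^sub>M torus_borel)"
      using \<xi> by measurable
    from measurable_compose[OF this measurable_f] show ?thesis by simp
  qed
  have ppp: "poisson_point_process H ?\<Lambda> (\<lambda>h. point_configuration borel UNIV (\<lambda>k. \<tau> k h))"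
    using \<tau> by (simp add: homogeneous_poisson_process_def)
  have g01: "0 \<le> ?g v \<and> ?g v \<le> 1" for v using f_bounds[OF \<xi>] by (auto intro: less_imp_le)
  note L = poisson_laplace_functional[OF H.prob_space_axioms ppp, where D = "{0..t}" and g = ?g, simplified]
  have meas: "(\<lambda>h. \<Prod>k\<in>{k. \<tau> k h \<in> {0..t}}. ?g (\<tau> k h)) \<in> borel_measurable H"
    and int: "(\<integral>h. (\<Prod>k\<in>{k. \<tau> k h \<in> {0..t}}. ?g (\<tau> k h)) \<partial>H) =
      exp (- (LINT v:{0..t}|?\<Lambda>. f \<xi> (torus_path W s (max 0 v) p)))"
    using L events_intensity_finite g01 by auto
  have "(LINT v:{0..t}|?\<Lambda>. f \<xi> (torus_path W s (max 0 v) p)) =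
      (LINT v:{0..t}|lborel. reaction_field qmax b w \<phi> \<xi> (torus_path W s v p))"
    unfolding set_lebesgue_integral_def using qmax
    by (subst integral_density)
      (auto intro!: Bochner_Integration.integral_cong simp: reaction_field_def split: split_indicator)
  moreover have "(\<integral>\<^sup>+ h. ennreal (\<Prod>k\<in>{k. \<tau> k h \<in> {0..t}}. ?g (\<tau> k h)) \<partial>H) =
      ennreal (\<integral>h. (\<Prod>k\<in>{k. \<tau> k h \<in> {0..t}}. ?g (\<tau> k h)) \<partial>H)"
  proof (intro nn_integral_eq_integral H.integrable_const_bound[where B = 1] AE_I2 meas)
    fix h
    show "0 \<le> (\<Prod>k\<in>{k. \<tau> k h \<in> {0..t}}. ?g (\<tau> k h))" using g01 by (intro prod_nonneg) blast
    moreover have "(\<Prod>k\<in>{k. \<tau> k h \<in> {0..t}}. ?g (\<tau> k h)) \<le> 1" using g01 by (intro prod_le_1) blast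
    ultimately show "norm (\<Prod>k\<in>{k. \<tau> k h \<in> {0..t}}. ?g (\<tau> k h)) \<le> 1" by simp
  qed
  ultimately show ?thesis by (simp only: int)
qed

lemma finite_event_times: "AE h in H. finite {k. \<tau> k h \<in> {0..t}}"
proof -
  let ?\<Lambda> = "density lborel (\<lambda>v. ennreal (qmax * indicator {0..} v))"
  have ppp: "poisson_point_process H ?\<Lambda> (\<lambda>h. point_configuration borel UNIV (\<lambda>k. \<tau> k h))"
    using \<tau> by (simp add: homogeneous_poisson_process_def)
  have "AE h in H. emeasure (point_configuration borel UNIV (\<lambda>k. \<tau> k h)) {0..t} =
      of_nat (count_in (point_configuration borel UNIV (\<lambda>k. \<tau> k h)) {0..t})"
    by (rule poisson_count_AE_finite[OF H.prob_space_axioms ppp]) (use events_intensity_finite in auto)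
  then show ?thesis
  proof eventually_elim
    case (elim h)
    have "emeasure (point_configuration borel UNIV (\<lambda>k. \<tau> k h)) {0..t} =
        emeasure (count_space UNIV) {k \<in> UNIV. \<tau> k h \<in> {0..t}}"
      by (rule emeasure_point_configuration) auto
    with elim have "emeasure (count_space UNIV) {k. \<tau> k h \<in> {0..t}} \<noteq> \<top>"
      by (simp add: ennreal_of_nat_eq_real_of_nat)
    then show ?case by (auto simp: emeasure_count_space split: if_splits)
  qed
qed

text \<open>The integral over the seed is taken in the order marks, event times, path, exponential time.  The
joint measurability in time and path of the exponential functional is not evident from its formula;
it is inherited from the fact that this functional is the inner integral of a measurable function.\<close>

lemma forward_coin_prob:
  assumes \<xi>: "\<xi> \<in> space coefficient_space"
  shows "emeasure F {z \<in> space F. coin \<xi> s z} =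
      ennreal (survival_prob lam P W s (reaction_field qmax b w \<phi> \<xi>))"
    and "0 \<le> survival_prob lam P W s (reaction_field qmax b w \<phi> \<xi>)"
    and "{z \<in> space F. coin \<xi> s z} \<in> sets F"
proof -
  let ?A = "{z \<in> space F. coin \<xi> s z}"
  let ?R = "\<lambda>t p. exp (- (LINT v:{0..t}|lborel. reaction_field qmax b w \<phi> \<xi> (torus_path W s v p)))"
  show A: "?A \<in> sets F"
  proof -
    have "(\<lambda>z. (\<xi>, z)) \<in> measurable F (coefficient_space \<Otimes>\<^sub>M F)" using \<xi> by simp
    from measurable_compose[OF this measurable_coin] show ?thesis by simp
  qed
  define G where "G = (\<lambda>t p h. \<integral>\<^sup>+ u. indicator ?A (t, h, p, u) \<partial>mark_law)"
  have A'[measurable]: "?A \<in> sets (T_law \<Otimes>\<^sub>M H \<Otimes>\<^sub>M P \<Otimes>\<^sub>M mark_law)"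
    using A unfolding forward_seed_space_def .
  have G_meas: "(\<lambda>z. G (fst z) (snd (snd z)) (fst (snd z))) \<in> borel_measurable (T_law \<Otimes>\<^sub>M H \<Otimes>\<^sub>M P)"
    unfolding G_def by measurable
  have inner: "(\<integral>\<^sup>+ h. G t p h \<partial>H) = ennreal (?R t p)" if "p \<in> space P" for t p
  proof -
    have "(\<integral>\<^sup>+ h. G t p h \<partial>H) =
      (\<integral>\<^sup>+ h. ennreal (\<Prod>k\<in>{k. \<tau> k h \<in> {0..t}}. 1 - f \<xi> (torus_path W s (max 0 (\<tau> k h)) p)) \<partial>H)"
    proof (rule nn_integral_cong_AE)
      show "AE h in H. G t p h = ennreal (\<Prod>k\<in>{k. \<tau> k h \<in> {0..t}}. 1 - f \<xi> (torus_path W s (max 0 (\<tau> k h)) p))"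
        using finite_event_times[of t] AE_space
      proof eventually_elim
        case (elim h)
        with nn_integral_over_marks[OF \<xi> elim(1), of s p] that show ?case by (simp add: G_def)
      qed
    qed
    also have "\<dots> = ennreal (?R t p)" by (rule laplace_over_event_times[OF \<xi> that])
    finally show ?thesis .
  qed
  have R_meas: "(\<lambda>z. ?R (fst z) (snd z)) \<in> borel_measurable (T_law \<Otimes>\<^sub>M P)"
  proof -
    have "(\<lambda>z. enn2real (\<integral>\<^sup>+ h. G (fst z) (snd z) h \<partial>H)) \<in> borel_measurable (T_law \<Otimes>\<^sub>M P)"
    proof -
      have "(\<lambda>y. G (fst (fst y)) (snd (fst y)) (snd y)) \<in> borel_measurable ((T_law \<Otimes>\<^sub>M P) \<Otimes>\<^sub>M H)"
        by (rule measurable_compose[OF _ G_meas, where f = "\<lambda>y. (fst (fst y), snd y, snd (fst y))", simplified]) measurable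
      then show ?thesis by measurable
    qed
    also have "?this \<longleftrightarrow> ?thesis"
      by (rule measurable_cong) (auto simp: inner space_pair_measure)
    finally show ?thesis .
  qed
  have R01: "0 \<le> ?R t p" "?R t p \<le> 1" for t p
  proof -
    have "0 \<le> (LINT v:{0..t}|lborel. reaction_field qmax b w \<phi> \<xi> (torus_path W s v p))"
      unfolding set_lebesgue_integral_def reaction_field_def using qmax f_bounds[OF \<xi>]
      by (intro Bochner_Integration.integral_nonneg) (simp add: less_imp_le)
    then show "0 \<le> ?R t p" "?R t p \<le> 1" by auto
  qed
  interpret TP: pair_prob_space T_law P by unfold_locales
  interpret HP: pair_prob_space H P by unfold_locales
  interpret PU: pair_prob_space P mark_law by unfold_locales
  interpret HPU: prob_space "H \<Otimes>\<^sub>M P \<Otimes>\<^sub>M mark_law"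
    by (intro prob_space_pair H.prob_space_axioms P.prob_space_axioms marks.prob_space_axioms)
  have "emeasure F ?A = (\<integral>\<^sup>+ z. indicator ?A z \<partial>(T_law \<Otimes>\<^sub>M H \<Otimes>\<^sub>M P \<Otimes>\<^sub>M mark_law))"
    unfolding nn_integral_indicator[OF A'] by (simp only: forward_seed_space_def)
  also have "\<dots> = (\<integral>\<^sup>+ t. \<integral>\<^sup>+ r. indicator ?A (t, r) \<partial>(H \<Otimes>\<^sub>M P \<Otimes>\<^sub>M mark_law) \<partial>T_law)"
    by (rule HPU.nn_integral_fst[symmetric]) measurable
  also have "\<dots> = (\<integral>\<^sup>+ t. \<integral>\<^sup>+ p. \<integral>\<^sup>+ h. G t p h \<partial>H \<partial>P \<partial>T_law)"
  proof (intro nn_integral_cong)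
    fix t assume t: "t \<in> space T_law"
    have [measurable]: "(\<lambda>r. indicator ?A (t, r) :: ennreal) \<in> borel_measurable (H \<Otimes>\<^sub>M P \<Otimes>\<^sub>M mark_law)"
      using t by measurable
    have "(\<integral>\<^sup>+ r. indicator ?A (t, r) \<partial>(H \<Otimes>\<^sub>M P \<Otimes>\<^sub>M mark_law)) =
        (\<integral>\<^sup>+ h. \<integral>\<^sup>+ r. indicator ?A (t, h, r) \<partial>(P \<Otimes>\<^sub>M mark_law) \<partial>H)"
      by (rule PU.nn_integral_fst[symmetric, where f = "\<lambda>r. indicator ?A (t, r)"]) measurable
    also have "\<dots> = (\<integral>\<^sup>+ h. \<integral>\<^sup>+ p. G t p h \<partial>P \<partial>H)"
      unfolding G_def
    proof (intro nn_integral_cong)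
      fix h assume h: "h \<in> space H"
      have "(\<lambda>r. indicator ?A (t, h, r) :: ennreal) \<in> borel_measurable (P \<Otimes>\<^sub>M mark_law)"
        using t h by measurable
      from marks.nn_integral_fst[OF this]
      show "(\<integral>\<^sup>+ r. indicator ?A (t, h, r) \<partial>(P \<Otimes>\<^sub>M mark_law)) =
          (\<integral>\<^sup>+ p. \<integral>\<^sup>+ u. indicator ?A (t, h, p, u) \<partial>mark_law \<partial>P)" by simp
    qed
    also have "\<dots> = (\<integral>\<^sup>+ p. \<integral>\<^sup>+ h. G t p h \<partial>H \<partial>P)"
    proof (rule HP.Fubini'[symmetric])
      have "(\<lambda>y. (t, y)) \<in> measurable (H \<Otimes>\<^sub>M P) (T_law \<Otimes>\<^sub>M H \<Otimes>\<^sub>M P)" using t by simp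
      from measurable_compose[OF this G_meas]
      show "(\<lambda>(h, p). G t p h) \<in> borel_measurable (H \<Otimes>\<^sub>M P)" by (simp add: split_beta')
    qed
    finally show "(\<integral>\<^sup>+ r. indicator ?A (t, r) \<partial>(H \<Otimes>\<^sub>M P \<Otimes>\<^sub>M mark_law)) = (\<integral>\<^sup>+ p. \<integral>\<^sup>+ h. G t p h \<partial>H \<partial>P)" .
  qed
  also have "\<dots> = (\<integral>\<^sup>+ t. \<integral>\<^sup>+ p. ennreal (?R t p) \<partial>P \<partial>T_law)"
    by (intro nn_integral_cong) (simp add: inner)
  also have "\<dots> = (\<integral>\<^sup>+ z. ennreal (?R (fst z) (snd z)) \<partial>(T_law \<Otimes>\<^sub>M P))"
    using P.nn_integral_fst[of "\<lambda>z. ennreal (?R (fst z) (snd z))" T_law] R_meas by simp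
  also have "\<dots> = ennreal (\<integral>z. ?R (fst z) (snd z) \<partial>(T_law \<Otimes>\<^sub>M P))"
    using R_meas R01 by (intro nn_integral_eq_integral TP.integrable_const_bound[where B = 1]) auto
  finally show "emeasure F ?A = ennreal (survival_prob lam P W s (reaction_field qmax b w \<phi> \<xi>))"
    by (simp add: survival_prob_def split_beta')
  show "0 \<le> survival_prob lam P W s (reaction_field qmax b w \<phi> \<xi>)"
    unfolding survival_prob_def by (intro Bochner_Integration.integral_nonneg) auto
qed

end

section \<open>The Bernstein--Poisson likelihood factory\<close>

text \<open>Inserting the first two factorial moments of the binomial law into the Bernstein coefficients
returns the polynomial \<open>(p - y)\<^sup>2\<close>.\<close>

lemma bernstein_coeff_expectation:
  assumes n: "2 \<le> n"
  shows "y\<^sup>2 - 2 * y * (real n * p) / real n + real n * (real n - 1) * p\<^sup>2 / (real n * (real n - 1)) = (p - y)\<^sup>2"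
  using n by (simp add: power2_eq_square field_simps)

text \<open>The smallest coefficient is at most their binomial average with parameter \<open>p = y\<close>, which is
\<open>(y - y)\<^sup>2 = 0\<close>.\<close>

lemma bernstein_shift_nonneg:
  assumes n: "2 \<le> n" and y: "0 \<le> y" "y \<le> 1"
  shows "0 \<le> bernstein_shift n y"
proof -
  let ?B = "\<lambda>k. Bernstein n k y" and ?m = "Min ((\<lambda>k. bernstein_coeff k n y) ` {0..n})"
  have "?m = (\<Sum>k\<le>n. ?m * ?B k)" by (simp add: sum_distrib_left[symmetric])
  also have "\<dots> \<le> (\<Sum>k\<le>n. bernstein_coeff k n y * ?B k)"
    using y by (intro sum_mono mult_right_mono Bernstein_nonneg Min_le) auto
  also have "\<dots> = y\<^sup>2 * (\<Sum>k\<le>n. ?B k) - 2 * y / real n * (\<Sum>k\<le>n. real k * ?B k) +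
      (\<Sum>k\<le>n. real k * (real k - 1) * ?B k) / (real n * (real n - 1))"
    by (simp only: sum_distrib_left sum_divide_distrib sum_subtractf[symmetric] sum.distrib[symmetric])
      (simp add: bernstein_coeff_def algebra_simps)
  also have "\<dots> = 0"
    using bernstein_coeff_expectation[OF n, of y y] by simp
  finally have "?m \<le> 0" .
  then show ?thesis unfolding bernstein_shift_def by linarith
qed

lemma shifted_coeff_nonneg: "k \<le> n \<Longrightarrow> 0 \<le> shifted_coeff k n y"
  unfolding shifted_coeff_def bernstein_shift_def
  using Min_le[of "(\<lambda>k. bernstein_coeff k n y) ` {0..n}" "bernstein_coeff k n y"]
  by (simp del: minus_Min_eq_Max)

lemma coeff_scale_ge_1: "1 \<le> coeff_scale n y"
  by (simp add: coeff_scale_def)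

lemma shifted_coeff_le_scale: "k \<le> n \<Longrightarrow> shifted_coeff k n y \<le> coeff_scale n y"
  unfolding coeff_scale_def by (intro max.coboundedI2 Max_ge) auto

lemma prob_space_component_seed_space: "prob_space F \<Longrightarrow> prob_space (component_seed_space F a n y)"
  unfolding component_seed_space_def
  by (intro prob_space_pair prob_space_PiM prob_space_unit_uniform measure_pmf.prob_space_axioms)

lemma prob_space_candidate_seed_space: "prob_space F \<Longrightarrow> prob_space (candidate_seed_space F J a n y)"
  unfolding candidate_seed_space_def by (intro prob_space_PiM prob_space_component_seed_space)

text \<open>The candidate enters as a parameter \<open>x \<in> X\<close>, because the retention decision must be measurable
jointly in the coefficients and the seed.\<close>

lemma measurable_auxiliary_variable:
  assumes coin: "Measurable.pred (X \<Otimes>\<^sub>M F) (\<lambda>q. coin (fst q) (snd q))"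
  shows "Measurable.pred (X \<Otimes>\<^sub>M (unit_uniform \<Otimes>\<^sub>M (\<Pi>\<^sub>M m\<in>UNIV. F)))
    (\<lambda>q. auxiliary_variable (coin (fst q)) n y (snd q))"
proof -
  let ?S = "X \<Otimes>\<^sub>M (unit_uniform \<Otimes>\<^sub>M (\<Pi>\<^sub>M m\<in>(UNIV :: nat set). F))"
  have [measurable]: "Measurable.pred ?S (\<lambda>q. coin (fst q) (snd (snd q) m))" for m
  proof -
    have "(\<lambda>q. (fst q, snd (snd q) m)) \<in> measurable ?S (X \<Otimes>\<^sub>M F)" by measurable
    from measurable_compose[OF this coin] show ?thesis by simp
  qed
  have card: "(\<lambda>q. card {m. m < n \<and> coin (fst q) (snd (snd q) m)}) \<in> measurable ?S (count_space UNIV)"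
  proof (rule measurable_card)
    show "{q \<in> space ?S. m \<in> {m. m < n \<and> coin (fst q) (snd (snd q) m)}} \<in> sets ?S" for m
      unfolding mem_Collect_eq by measurable
  qed
  have "(\<lambda>q. fst (snd q)) \<in> measurable ?S unit_uniform" by measurable
  then have "(\<lambda>q. fst (snd q)) \<in> borel_measurable ?S"
    by (simp add: measurable_cong_sets[OF refl sets_unit_uniform])
  moreover have "(\<lambda>q. shifted_coeff (card {m. m < n \<and> coin (fst q) (snd (snd q) m)}) n y / coeff_scale n y)
      \<in> borel_measurable ?S"
    by (rule measurable_compose[OF card]) simp
  ultimately show ?thesis
    unfolding auxiliary_variable_def split_beta' by (rule borel_measurable_pred_less)
qed

lemma measurable_component_coin:
  assumes coin: "Measurable.pred (X \<Otimes>\<^sub>M F) (\<lambda>q. coin (fst q) (snd q))"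
  shows "Measurable.pred (X \<Otimes>\<^sub>M component_seed_space F a n y)
    (\<lambda>q. component_coin (coin (fst q)) n y (snd q))"
proof -
  let ?S = "X \<Otimes>\<^sub>M component_seed_space F a n y"
  have [measurable]: "(\<lambda>q. fst (snd q)) \<in> measurable ?S (count_space UNIV)"
    unfolding component_seed_space_def by measurable
  have "(\<lambda>q. (fst q, snd (snd q) r)) \<in> measurable ?S (X \<Otimes>\<^sub>M (unit_uniform \<Otimes>\<^sub>M (\<Pi>\<^sub>M m\<in>UNIV. F)))" for r
    unfolding component_seed_space_def by measurable
  from measurable_compose[OF this measurable_auxiliary_variable[OF coin]]
  have [measurable]: "Measurable.pred ?S (\<lambda>q. auxiliary_variable (coin (fst q)) n y (snd (snd q) r))" for r by simp
  show ?thesis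
    unfolding component_coin_def split_beta' by (intro pred_intros_countable pred_intros_logic) measurable
qed

lemma measurable_retain_candidate:
  assumes coin: "\<And>x. Measurable.pred (X \<Otimes>\<^sub>M F) (\<lambda>q. coin (fst q) x (snd q))"
  shows "Measurable.pred (X \<Otimes>\<^sub>M candidate_seed_space F J a n y)
    (\<lambda>q. retain_candidate (coin (fst q)) J s n y (snd q))"
proof -
  let ?S = "X \<Otimes>\<^sub>M candidate_seed_space F J a n y"
  have "Measurable.pred ?S (\<lambda>q. component_coin (coin (fst q) (s j)) (n j) (y j) (snd q j))" if j: "j < J" for j
  proof -
    have "(\<lambda>q. (fst q, snd q j)) \<in> measurable ?S (X \<Otimes>\<^sub>M component_seed_space F (a j) (n j) (y j))"
    proof -
      have "(\<lambda>\<zeta>. \<zeta> j) \<in> measurable (candidate_seed_space F J a n y) (component_seed_space F (a j) (n j) (y j))"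
        unfolding candidate_seed_space_def using j by (intro measurable_component_singleton) simp
      then show ?thesis by measurable
    qed
    from measurable_compose[OF this measurable_component_coin[OF coin, of "s j"]] show ?thesis by simp
  qed
  then have "Measurable.pred ?S (\<lambda>q. \<forall>j\<in>{..<J}. component_coin (coin (fst q) (s j)) (n j) (y j) (snd q j))"
    by (intro pred_intros_finite) auto
  then show ?thesis unfolding retain_candidate_def Ball_def by (simp only: lessThan_iff)
qed

text \<open>Statements about a single candidate are the case of a parameter space with one point.\<close>

lemma pred_fixed_parameter:
  assumes "Measurable.pred F c"
  shows "Measurable.pred (count_space (UNIV :: unit set) \<Otimes>\<^sub>M F) (\<lambda>q. c (snd q))"
  using assms by measurable

lemma measurable_component_coin_fixed:
  assumes "Measurable.pred F coin"
  shows "Measurable.pred (component_seed_space F a n y) (component_coin coin n y)"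
  using measurable_compose[OF measurable_Pair1'[of "()" "count_space UNIV"]
      measurable_component_coin[OF pred_fixed_parameter[OF assms], where a = a and n = n and y = y]] by simp

lemma measurable_auxiliary_variable_fixed:
  assumes "Measurable.pred F coin"
  shows "Measurable.pred (unit_uniform \<Otimes>\<^sub>M (\<Pi>\<^sub>M m\<in>UNIV. F)) (auxiliary_variable coin n y)"
  using measurable_compose[OF measurable_Pair1'[of "()" "count_space UNIV"]
      measurable_auxiliary_variable[OF pred_fixed_parameter[OF assms], where n = n and y = y]] by simp

text \<open>Writing the number of successes as a sum of indicators, its square is a double sum in which the
diagonal contributes \<open>p\<close> and every off-diagonal pair \<open>p\<^sup>2\<close>.\<close>

lemma success_count_moments:
  fixes F :: "'z measure" and n :: nat
  assumes F: "prob_space F" and coin: "Measurable.pred F coin"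
  defines "p \<equiv> measure F {z \<in> space F. coin z}"
    and "K \<equiv> \<lambda>z :: nat \<Rightarrow> 'z. real (card {m. m < n \<and> coin (z m)})"
  shows "integrable (\<Pi>\<^sub>M m\<in>UNIV. F) K" "integrable (\<Pi>\<^sub>M m\<in>UNIV. F) (\<lambda>z. K z * (K z - 1))"
    and "(\<integral>z. K z \<partial>(\<Pi>\<^sub>M m\<in>UNIV. F)) = real n * p"
    and "(\<integral>z. K z * (K z - 1) \<partial>(\<Pi>\<^sub>M m\<in>UNIV. F)) = real n * (real n - 1) * p\<^sup>2"
proof -
  interpret F: prob_space F by fact
  interpret PF: product_prob_space "\<lambda>_. F" "UNIV :: nat set" by unfold_locales
  let ?P = "\<Pi>\<^sub>M m\<in>(UNIV :: nat set). F"
  let ?A = "{z \<in> space F. coin z}"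
  let ?E = "\<lambda>m m'. {z \<in> space ?P. \<forall>i\<in>{m, m'}. z i \<in> ?A}"
  have A: "?A \<in> sets F" using coin by simp
  have E: "?E m m' \<in> sets ?P" for m m'
    using A by (intro sets.sets_Collect_finite_All) auto
  have pE: "measure ?P (?E m m') = (if m = m' then p else p\<^sup>2)" for m m'
  proof -
    have "emeasure ?P (?E m m') = (\<Prod>i\<in>{m, m'}. emeasure F ?A)"
      using A by (intro PF.emeasure_PiM_Collect) auto
    then show ?thesis
      by (auto simp: measure_def p_def enn2real_mult power2_eq_square)
  qed
  have K: "K z = (\<Sum>m<n. indicator (?E m m) z)" "K z * K z = (\<Sum>m<n. \<Sum>m'<n. indicator (?E m m') z)"
    if "z \<in> space ?P" for z
  proof -
    have z: "z m \<in> space F" for m using that by (auto simp: space_PiM)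
    have K0: "K z = (\<Sum>m<n. of_bool (coin (z m)))"
      unfolding K_def by (simp add: lessThan_def Collect_conj_eq[symmetric])
    show "K z = (\<Sum>m<n. indicator (?E m m) z)"
      unfolding K0 using z that by (intro sum.cong) (auto simp: indicator_def)
    show "K z * K z = (\<Sum>m<n. \<Sum>m'<n. indicator (?E m m') z)"
      unfolding K0 sum_product using z that by (intro sum.cong) (auto simp: indicator_def)
  qed
  have int1: "has_bochner_integral ?P K (\<Sum>m<n. p)"
  proof -
    have "has_bochner_integral ?P (\<lambda>z. \<Sum>m<n. indicator (?E m m) z) (\<Sum>m<n. measure ?P (?E m m))"
      by (intro has_bochner_integral_sum has_bochner_integral_real_indicator E)
        (simp add: PF.P.emeasure_eq_measure)
    then show ?thesis
      by (subst has_bochner_integral_cong[OF refl K(1) refl]) (simp_all only: pE if_True refl)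
  qed
  have int2: "has_bochner_integral ?P (\<lambda>z. K z * K z) (\<Sum>m<n. \<Sum>m'<n. if m = m' then p else p\<^sup>2)"
  proof -
    have "has_bochner_integral ?P (\<lambda>z. \<Sum>m<n. \<Sum>m'<n. indicator (?E m m') z) (\<Sum>m<n. \<Sum>m'<n. measure ?P (?E m m'))"
      by (intro has_bochner_integral_sum has_bochner_integral_real_indicator E)
        (simp add: PF.P.emeasure_eq_measure)
    then show ?thesis
      by (subst has_bochner_integral_cong[OF refl K(2) refl]) (simp_all only: pE)
  qed
  have sum2: "(\<Sum>m<n. \<Sum>m'<n. if m = m' then p else p\<^sup>2) = real n * p + real n * (real n - 1) * p\<^sup>2"
  proof -
    have "(\<Sum>m'<n. if m = m' then p else p\<^sup>2) = p + (real n - 1) * p\<^sup>2" if "m < n" for m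
    proof -
      have "(\<Sum>m'<n. if m = m' then p else p\<^sup>2) = (\<Sum>m'<n. p\<^sup>2 + (if m = m' then p - p\<^sup>2 else 0))"
        by (intro sum.cong) auto
      also have "\<dots> = real n * p\<^sup>2 + (p - p\<^sup>2)" using that by (simp add: sum.distrib)
      finally show ?thesis by (simp add: algebra_simps)
    qed
    then have "(\<Sum>m<n. \<Sum>m'<n. if m = m' then p else p\<^sup>2) = (\<Sum>m<n. p + (real n - 1) * p\<^sup>2)"
      by (intro sum.cong) auto
    then show ?thesis by (simp add: algebra_simps)
  qed
  have int3: "has_bochner_integral ?P (\<lambda>z. K z * K z - K z) (real n * (real n - 1) * p\<^sup>2)"
    using has_bochner_integral_diff[OF int2 int1] unfolding sum2 by simp
  have eq: "K z * (K z - 1) = K z * K z - K z" for z by (simp add: algebra_simps)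
  show "integrable ?P K" "(\<integral>z. K z \<partial>?P) = real n * p"
    using int1 by (auto simp: has_bochner_integral_iff)
  show "integrable ?P (\<lambda>z. K z * (K z - 1))"
      "(\<integral>z. K z * (K z - 1) \<partial>?P) = real n * (real n - 1) * p\<^sup>2"
    unfolding eq using int3 by (auto simp: has_bochner_integral_iff)
qed

text \<open>Given the number \<open>K\<close> of successes, the Bernoulli draw succeeds with probability \<open>c\<^sub>K / C\<close>, which lies in
\<open>[0, 1]\<close>; averaging over \<open>K\<close> uses only its first two factorial moments, since \<open>c\<^sub>K\<close> is quadratic in \<open>K\<close>.\<close>

lemma auxiliary_variable_prob:
  fixes F :: "'z measure" and y :: "real"
  assumes F: "prob_space F" and coin: "Measurable.pred F coin" and n: "2 \<le> n"
  defines "p \<equiv> measure F {z \<in> space F. coin z}" and "S \<equiv> unit_uniform \<Otimes>\<^sub>M (\<Pi>\<^sub>M m\<in>UNIV. F)"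
  defines "\<theta> \<equiv> ((p - y)\<^sup>2 + bernstein_shift n y) / coeff_scale n y"
  shows "emeasure S {x \<in> space S. auxiliary_variable coin n y x} = ennreal \<theta>" and "0 \<le> \<theta>" "\<theta> \<le> 1"
proof -
  let ?P = "\<Pi>\<^sub>M m\<in>(UNIV :: nat set). F"
  interpret F: prob_space F by fact
  interpret P: prob_space ?P by (intro prob_space_PiM F)
  interpret U: prob_space unit_uniform by (rule prob_space_unit_uniform)
  interpret UP: pair_prob_space unit_uniform ?P by unfold_locales
  let ?A = "{x \<in> space S. auxiliary_variable coin n y x}"
  have A: "?A \<in> sets S" using measurable_auxiliary_variable_fixed[OF coin] by (simp add: S_def)
  define K where "K z = card {m. m < n \<and> coin (z m)}" for z :: "nat \<Rightarrow> 'z"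
  define c where "c z = shifted_coeff (K z) n y / coeff_scale n y" for z
  note mom = success_count_moments[OF F coin, of n, folded p_def K_def]
  have Kn: "K z \<le> n" for z
    unfolding K_def using card_mono[of "{..<n}" "{m. m < n \<and> coin (z m)}"] by auto
  have c01: "0 \<le> c z" "c z \<le> 1" for z
    using shifted_coeff_nonneg[OF Kn, of z y] shifted_coeff_le_scale[OF Kn, of z y] coeff_scale_ge_1[of n y]
    by (auto simp: c_def divide_le_eq)
  have "has_bochner_integral ?P (\<lambda>z. (y\<^sup>2 - 2 * y / real n * real (K z) +
      real (K z) * (real (K z) - 1) / (real n * (real n - 1)) + bernstein_shift n y) / coeff_scale n y)
      ((y\<^sup>2 - 2 * y / real n * (real n * p) +
      real n * (real n - 1) * p\<^sup>2 / (real n * (real n - 1)) + bernstein_shift n y) / coeff_scale n y)"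
    using mom P.prob_space
    by (intro has_bochner_integral_divide_zero has_bochner_integral_add has_bochner_integral_diff
      has_bochner_integral_mult_right) (auto simp: has_bochner_integral_iff)
  moreover have "(\<lambda>z. (y\<^sup>2 - 2 * y / real n * real (K z) +
      real (K z) * (real (K z) - 1) / (real n * (real n - 1)) + bernstein_shift n y) / coeff_scale n y) = c"
    by (simp add: c_def shifted_coeff_def bernstein_coeff_def fun_eq_iff)
  moreover have "(y\<^sup>2 - 2 * y / real n * (real n * p) +
      real n * (real n - 1) * p\<^sup>2 / (real n * (real n - 1)) + bernstein_shift n y) / coeff_scale n y = \<theta>"
    unfolding \<theta>_def bernstein_coeff_expectation[OF n, symmetric] by simp
  ultimately have c: "has_bochner_integral ?P c \<theta>" by simp
  have "emeasure S ?A = (\<integral>\<^sup>+ z. emeasure unit_uniform ((\<lambda>v. (v, z)) -` ?A) \<partial>?P)"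
    using A unfolding S_def by (rule UP.emeasure_pair_measure_alt2)
  also have "\<dots> = (\<integral>\<^sup>+ z. ennreal (c z) \<partial>?P)"
  proof (intro nn_integral_cong)
    fix z assume z: "z \<in> space ?P"
    have "(\<lambda>v. (v, z)) -` ?A = {v. v < c z}"
      using z by (auto simp: S_def space_pair_measure auxiliary_variable_def c_def K_def)
    then show "emeasure unit_uniform ((\<lambda>v. (v, z)) -` ?A) = ennreal (c z)"
      using emeasure_unit_uniform_less[OF c01] by simp
  qed
  also have "\<dots> = ennreal (\<integral>z. c z \<partial>?P)"
    using c c01 by (intro nn_integral_eq_integral) (auto simp: has_bochner_integral_iff)
  also have "\<dots> = ennreal \<theta>" using c by (simp add: has_bochner_integral_iff)
  finally show "emeasure S ?A = ennreal \<theta>" .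
  have "\<theta> = (\<integral>z. c z \<partial>?P)" using c by (simp add: has_bochner_integral_iff)
  then show "0 \<le> \<theta>" "\<theta> \<le> 1"
    using c01 c by (auto intro!: Bochner_Integration.integral_nonneg P.integral_le_const simp: has_bochner_integral_iff)
qed

text \<open>No success among a Poisson number of independent trials: the generating function
\<open>exp (- rate (1 - s))\<close> at \<open>s = 1 - \<theta>\<close>.  The scale \<open>C\<close> in the rate cancels the one in
\<open>\<theta>\<close>.\<close>

lemma component_coin_prob:
  fixes F :: "'z measure" and y :: "real"
  assumes F: "prob_space F" and coin: "Measurable.pred F coin" and n: "2 \<le> n" and a: "0 < a"
  defines "p \<equiv> measure F {z \<in> space F. coin z}" and "S \<equiv> component_seed_space F a n y"
  shows "emeasure S {x \<in> space S. component_coin coin n y x} = ennreal (exp (- (a * ((p - y)\<^sup>2 + bernstein_shift n y))))"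
proof -
  let ?X = "unit_uniform \<Otimes>\<^sub>M (\<Pi>\<^sub>M m\<in>(UNIV :: nat set). F)"
  let ?P = "\<Pi>\<^sub>M r\<in>(UNIV :: nat set). ?X"
  let ?rate = "a * coeff_scale n y"
  define \<theta> where "\<theta> = ((p - y)\<^sup>2 + bernstein_shift n y) / coeff_scale n y"
  have rate: "0 < ?rate" using a coeff_scale_ge_1[of n y] by (intro mult_pos_pos) auto
  interpret X: prob_space ?X by (intro prob_space_pair prob_space_PiM F prob_space_unit_uniform)
  interpret PX: product_prob_space "\<lambda>_. ?X" "UNIV :: nat set" by unfold_locales
  let ?B = "{x \<in> space ?X. \<not> auxiliary_variable coin n y x}"
  note aux = auxiliary_variable_prob[OF F coin n, of y, folded p_def, folded \<theta>_def]
  have pred: "Measurable.pred ?X (auxiliary_variable coin n y)" by (rule measurable_auxiliary_variable_fixed[OF coin])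
  have B: "?B \<in> sets ?X" using pred by measurable
  have pB: "emeasure ?X ?B = ennreal (1 - \<theta>)"
  proof -
    have "X.prob {x \<in> space ?X. \<not> auxiliary_variable coin n y x} = 1 - X.prob {x \<in> space ?X. auxiliary_variable coin n y x}"
      by (intro X.prob_neg predE pred)
    then show ?thesis using aux by (simp add: X.emeasure_eq_measure)
  qed
  let ?A = "{x \<in> space S. component_coin coin n y x}"
  have A: "?A \<in> sets S" using measurable_component_coin_fixed[OF coin, where a = a and n = n and y = y] by (simp add: S_def)
  have "emeasure S ?A = (\<integral>\<^sup>+ R. emeasure ?P (Pair R -` ?A) \<partial>measure_pmf (poisson_pmf ?rate))"
    using A unfolding S_def component_seed_space_def by (rule PX.P.emeasure_pair_measure_alt)
  also have "\<dots> = (\<integral>\<^sup>+ R. ennreal ((1 - \<theta>) ^ R) \<partial>measure_pmf (poisson_pmf ?rate))"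
  proof (intro nn_integral_cong)
    fix R
    have "Pair R -` ?A = {x \<in> space ?P. \<forall>r\<in>{..<R}. x r \<in> ?B}"
      by (auto simp: S_def component_seed_space_def space_pair_measure component_coin_def space_PiM)
    then have "emeasure ?P (Pair R -` ?A) = (\<Prod>r<R. emeasure ?X ?B)"
      using B PX.emeasure_PiM_Collect[of "{..<R}" "\<lambda>_. ?B"] by simp
    also have "\<dots> = ennreal ((1 - \<theta>) ^ R)"
      using aux by (simp add: pB ennreal_power)
    finally show "emeasure ?P (Pair R -` ?A) = ennreal ((1 - \<theta>) ^ R)" .
  qed
  also have "\<dots> = ennreal (measure_pmf.expectation (poisson_pmf ?rate) (\<lambda>R. (1 - \<theta>) ^ R))"
    using aux by (intro nn_integral_eq_integral measure_pmf.integrable_const_bound[where B = 1])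
      (auto simp: power_le_one)
  also have "measure_pmf.expectation (poisson_pmf ?rate) (\<lambda>R. (1 - \<theta>) ^ R) = exp (- (?rate * (1 - (1 - \<theta>))))"
    using aux rate by (intro measure_pmf.poisson_pgf) (auto simp: pmf.rep_eq[symmetric] measure_pmf_single)
  also have "?rate * (1 - (1 - \<theta>)) = a * ((p - y)\<^sup>2 + bernstein_shift n y)"
    using coeff_scale_ge_1[of n y] by (simp add: \<theta>_def)
  finally show ?thesis .
qed

lemma retain_candidate_prob:
  fixes F :: "'z measure" and y :: "nat \<Rightarrow> real"
  assumes F: "prob_space F" and coin: "\<And>x. Measurable.pred F (coin x)"
    and n: "\<And>j. j < J \<Longrightarrow> 2 \<le> n j" and a: "\<And>j. j < J \<Longrightarrow> 0 < a j"
  defines "p \<equiv> \<lambda>x. measure F {z \<in> space F. coin x z}" and "S \<equiv> candidate_seed_space F J a n y"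
  shows "emeasure S {\<zeta> \<in> space S. retain_candidate coin J s n y \<zeta>} =
    ennreal (exp (- (\<Sum>j<J. a j * (p (s j) - y j)\<^sup>2)) * exp (- total_shift J a n y))"
proof -
  let ?C = "\<lambda>j. component_seed_space F (a j) (n j) (y j)"
  let ?A = "\<lambda>j. {x \<in> space (?C j). component_coin (coin (s j)) (n j) (y j) x}"
  interpret C: prob_space "?C j" for j by (rule prob_space_component_seed_space[OF F])
  interpret PC: product_prob_space ?C "{..<J}" by unfold_locales
  have A: "?A j \<in> sets (?C j)" for j using measurable_component_coin_fixed[OF coin] by simp
  have "{\<zeta> \<in> space S. retain_candidate coin J s n y \<zeta>} = {\<zeta> \<in> space (PiM {..<J} ?C). \<forall>j\<in>{..<J}. \<zeta> j \<in> ?A j}"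
    by (auto simp: S_def candidate_seed_space_def retain_candidate_def space_PiM)
  then have "emeasure S {\<zeta> \<in> space S. retain_candidate coin J s n y \<zeta>} = (\<Prod>j<J. emeasure (?C j) (?A j))"
    using PC.emeasure_PiM_Collect[of "{..<J}" ?A] A by (simp add: S_def candidate_seed_space_def)
  also have "\<dots> = (\<Prod>j<J. ennreal (exp (- (a j * ((p (s j) - y j)\<^sup>2 + bernstein_shift (n j) (y j))))))"
    unfolding p_def using n a by (intro prod.cong refl component_coin_prob[OF F coin]) auto
  also have "\<dots> = ennreal (exp (\<Sum>j<J. - (a j * ((p (s j) - y j)\<^sup>2 + bernstein_shift (n j) (y j)))))"
    by (simp add: prod_ennreal exp_sum)
  also have "(\<Sum>j<J. - (a j * ((p (s j) - y j)\<^sup>2 + bernstein_shift (n j) (y j)))) =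
      - (\<Sum>j<J. a j * (p (s j) - y j)\<^sup>2) + - total_shift J a n y"
    by (simp add: total_shift_def sum_negf sum.distrib sum_subtractf distrib_left)
  finally show ?thesis by (simp only: exp_add)
qed

section \<open>Independent thinning\<close>

lemma scale_measure_eq_density: "scale_measure r M = density M (\<lambda>_. r)"
  by (rule measure_eqI) (auto simp: emeasure_density nn_integral_cmult_indicator)

lemma nn_integral_prod_iid:
  fixes n :: nat
  assumes "prob_space K" and f: "\<And>i. i < n \<Longrightarrow> f i \<in> borel_measurable K"
  shows "(\<integral>\<^sup>+ z. (\<Prod>i<n. f i (z i)) \<partial>(\<Pi>\<^sub>M i\<in>UNIV. K)) = (\<Prod>i<n. \<integral>\<^sup>+ z. f i z \<partial>K)"
proof -
  interpret K: prob_space K by fact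
  interpret PK: product_prob_space "\<lambda>_. K" "UNIV :: nat set" by unfold_locales
  have meas: "(\<lambda>z. \<Prod>i<n. f i (z i)) \<in> borel_measurable (\<Pi>\<^sub>M i\<in>{..<n}. K)"
  proof (intro borel_measurable_prod_ennreal)
    fix i assume i: "i \<in> {..<n}"
    show "(\<lambda>z. f i (z i)) \<in> borel_measurable (\<Pi>\<^sub>M i\<in>{..<n}. K)"
      by (rule measurable_compose[OF measurable_component_singleton[OF i]]) (use f i in simp)
  qed
  have "(\<Prod>i<n. \<integral>\<^sup>+ z. f i z \<partial>K) = (\<integral>\<^sup>+ z. (\<Prod>i<n. f i (z i)) \<partial>(\<Pi>\<^sub>M i\<in>{..<n}. K))"
    using f by (intro PK.product_nn_integral_prod[symmetric]) auto
  also have "\<dots> = (\<integral>\<^sup>+ z. (\<Prod>i<n. f i (z i))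
      \<partial>distr (\<Pi>\<^sub>M i\<in>UNIV. K) (\<Pi>\<^sub>M i\<in>{..<n}. K) (\<lambda>x. restrict x {..<n}))"
    by (subst PK.distr_PiM_restrict_finite) auto
  also have "\<dots> = (\<integral>\<^sup>+ z. (\<Prod>i<n. f i (restrict z {..<n} i)) \<partial>(\<Pi>\<^sub>M i\<in>UNIV. K))"
    using meas by (intro nn_integral_distr measurable_restrict_subset) simp_all
  also have "\<dots> = (\<integral>\<^sup>+ z. (\<Prod>i<n. f i (z i)) \<partial>(\<Pi>\<^sub>M i\<in>UNIV. K))"
    by (intro nn_integral_cong prod.cong) auto
  finally show ?thesis ..
qed

text \<open>Given the candidates, the retention decisions are independent, and candidate \<open>\<xi>\<close> contributes
\<open>h \<xi>\<close> with probability \<open>r \<xi>\<close> and \<open>1\<close> otherwise, that is \<open>1 - r \<xi> (1 - h \<xi>)\<close> on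
average.  Conditioning on all candidates at once lets
their number and their positions depend on each other in any way.\<close>

lemma thinning_integral:
  fixes N :: "'w \<Rightarrow> nat" and \<Xi> :: "'w \<Rightarrow> nat \<Rightarrow> 'x" and \<zeta> :: "'w \<Rightarrow> nat \<Rightarrow> 'z"
    and h r :: "'x \<Rightarrow> real"
  defines "CS X \<equiv> count_space UNIV \<Otimes>\<^sub>M (\<Pi>\<^sub>M i\<in>(UNIV :: nat set). X)"
    and "SS K \<equiv> \<Pi>\<^sub>M i\<in>(UNIV :: nat set). K"
  assumes M: "prob_space M" and K: "prob_space K"
    and N: "N \<in> measurable M (count_space UNIV)" and \<Xi>: "\<And>i. (\<lambda>\<omega>. \<Xi> \<omega> i) \<in> measurable M X"
    and \<zeta>: "\<zeta> \<in> measurable M (SS K)" "distr M (SS K) \<zeta> = SS K"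
    and indep: "distr M (CS X \<Otimes>\<^sub>M SS K) (\<lambda>\<omega>. ((N \<omega>, \<Xi> \<omega>), \<zeta> \<omega>)) =
      distr M (CS X) (\<lambda>\<omega>. (N \<omega>, \<Xi> \<omega>)) \<Otimes>\<^sub>M distr M (SS K) \<zeta>"
    and ret: "Measurable.pred (X \<Otimes>\<^sub>M K) (\<lambda>q. ret (fst q) (snd q))"
    and r: "\<And>\<xi>. \<xi> \<in> space X \<Longrightarrow> measure K {z \<in> space K. ret \<xi> z} = r \<xi>"
    and h: "h \<in> borel_measurable X" "\<And>\<xi>. \<xi> \<in> space X \<Longrightarrow> 0 \<le> h \<xi> \<and> h \<xi> \<le> 1"
  shows "(\<integral>\<omega>. (\<Prod>i\<in>{i. i < N \<omega> \<and> ret (\<Xi> \<omega> i) (\<zeta> \<omega> i)}. h (\<Xi> \<omega> i)) \<partial>M) =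
    (\<integral>\<omega>. (\<Prod>i<N \<omega>. 1 - r (\<Xi> \<omega> i) * (1 - h (\<Xi> \<omega> i))) \<partial>M)"
proof -
  interpret prob_space M by fact
  interpret K: prob_space K by fact
  interpret SS: prob_space "SS K" unfolding SS_def by (intro prob_space_PiM K)
  define v where "v \<xi> z = (if ret \<xi> z then h \<xi> else 1)" for \<xi> z
  define \<Phi> where "\<Phi> y = (\<Prod>i<fst (fst y). v (snd (fst y) i) (snd y i))" for y :: "(nat \<times> (nat \<Rightarrow> 'x)) \<times> (nat \<Rightarrow> 'z)"
  define g where "g \<xi> = 1 - r \<xi> * (1 - h \<xi>)" for \<xi>
  have ret_set: "{z \<in> space K. ret \<xi> z} \<in> sets K" if "\<xi> \<in> space X" for \<xi>
    using measurable_compose[OF measurable_Pair1'[OF that] ret] by simp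
  have v_meas: "(\<lambda>q. v (fst q) (snd q)) \<in> borel_measurable (X \<Otimes>\<^sub>M K)"
    unfolding v_def using ret measurable_compose[OF measurable_fst h(1)] by measurable
  have v01: "0 \<le> v \<xi> z \<and> v \<xi> z \<le> 1" if "\<xi> \<in> space X" for \<xi> z using h(2)[OF that] by (simp add: v_def)
  have v_int: "(\<integral>\<^sup>+ z. ennreal (v \<xi> z) \<partial>K) = ennreal (g \<xi>)" and g01: "0 \<le> g \<xi>" "g \<xi> \<le> 1"
    if \<xi>: "\<xi> \<in> space X" for \<xi>
  proof -
    have vm: "v \<xi> \<in> borel_measurable K"
      using measurable_compose[OF measurable_Pair1'[OF \<xi>] v_meas] by simp
    have "(\<integral>z. v \<xi> z \<partial>K) = (\<integral>z. 1 - (1 - h \<xi>) * indicator {z \<in> space K. ret \<xi> z} z \<partial>K)"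
      by (intro Bochner_Integration.integral_cong refl) (auto simp: v_def split: split_indicator)
    also have "\<dots> = 1 - (1 - h \<xi>) * measure K {z \<in> space K. ret \<xi> z}"
      using ret_set[OF \<xi>] by (subst Bochner_Integration.integral_diff) (auto simp: K.prob_space less_top[symmetric])
    finally have e: "(\<integral>z. v \<xi> z \<partial>K) = g \<xi>" by (simp add: r[OF \<xi>] g_def mult.commute)
    have int: "integrable K (v \<xi>)"
      using v01[OF \<xi>] vm by (intro K.integrable_const_bound[where B = 1]) auto
    then show "(\<integral>\<^sup>+ z. ennreal (v \<xi> z) \<partial>K) = ennreal (g \<xi>)"
      using v01[OF \<xi>] e by (subst nn_integral_eq_integral) auto
    show "0 \<le> g \<xi>" "g \<xi> \<le> 1"
      using v01[OF \<xi>] int unfolding e[symmetric]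
      by (auto intro!: Bochner_Integration.integral_nonneg K.integral_le_const)
  qed
  have \<Phi>_meas: "\<Phi> \<in> borel_measurable (CS X \<Otimes>\<^sub>M SS K)"
    unfolding \<Phi>_def
  proof (rule measurable_compose_countable[where f = "\<lambda>n y. \<Prod>i<n. v (snd (fst y) i) (snd y i)"])
    show "(\<lambda>y. fst (fst y)) \<in> measurable (CS X \<Otimes>\<^sub>M SS K) (count_space UNIV)"
      unfolding CS_def by measurable
    fix n
    have "(\<lambda>y. (snd (fst y) i, snd y i)) \<in> measurable (CS X \<Otimes>\<^sub>M SS K) (X \<Otimes>\<^sub>M K)" for i
      unfolding CS_def SS_def by measurable
    from measurable_compose[OF this v_meas]
    show "(\<lambda>y. \<Prod>i<n. v (snd (fst y) i) (snd y i)) \<in> borel_measurable (CS X \<Otimes>\<^sub>M SS K)"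
      by (intro borel_measurable_prod) simp
  qed
  have cand: "(\<lambda>\<omega>. (N \<omega>, \<Xi> \<omega>)) \<in> measurable M (CS X)"
    unfolding CS_def using N \<Xi> by (intro measurable_Pair measurable_PiM_single') (auto intro: measurable_space[OF \<Xi>])
  have joint: "(\<lambda>\<omega>. ((N \<omega>, \<Xi> \<omega>), \<zeta> \<omega>)) \<in> measurable M (CS X \<Otimes>\<^sub>M SS K)"
    using cand \<zeta>(1) by (intro measurable_Pair)
  have \<Xi>_space: "\<Xi> \<omega> i \<in> space X" if "\<omega> \<in> space M" for \<omega> i using measurable_space[OF \<Xi> that] .
  have \<Phi>_inner: "(\<integral>\<^sup>+ z. ennreal (\<Phi> (c, z)) \<partial>SS K) = ennreal (\<Prod>i<fst c. g (snd c i))" if c: "c \<in> space (CS X)" for c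
  proof -
    have cX: "snd c i \<in> space X" for i using c by (auto simp: CS_def space_pair_measure space_PiM)
    have "(\<integral>\<^sup>+ z. ennreal (\<Phi> (c, z)) \<partial>SS K) = (\<integral>\<^sup>+ z. (\<Prod>i<fst c. ennreal (v (snd c i) (z i))) \<partial>SS K)"
      using v01[OF cX] by (intro nn_integral_cong) (simp add: \<Phi>_def prod_ennreal)
    also have "\<dots> = (\<Prod>i<fst c. \<integral>\<^sup>+ z. ennreal (v (snd c i) z) \<partial>K)"
      unfolding SS_def
      using measurable_compose[OF measurable_Pair1'[OF cX] v_meas]
      by (intro nn_integral_prod_iid K measurable_compose[OF _ measurable_ennreal]) simp
    also have "\<dots> = ennreal (\<Prod>i<fst c. g (snd c i))"
      using g01[OF cX] by (simp add: v_int[OF cX] prod_ennreal)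
    finally show ?thesis .
  qed
  have left: "\<Phi> ((N \<omega>, \<Xi> \<omega>), \<zeta> \<omega>) = (\<Prod>i\<in>{i. i < N \<omega> \<and> ret (\<Xi> \<omega> i) (\<zeta> \<omega> i)}. h (\<Xi> \<omega> i))" for \<omega>
  proof -
    have eq: "{i. i < N \<omega> \<and> ret (\<Xi> \<omega> i) (\<zeta> \<omega> i)} = {i \<in> {..<N \<omega>}. ret (\<Xi> \<omega> i) (\<zeta> \<omega> i)}" by auto
    show ?thesis
      unfolding eq \<Phi>_def v_def fst_conv snd_conv by (rule prod.inter_filter[symmetric]) simp
  qed
  have \<Phi>01: "0 \<le> \<Phi> ((N \<omega>, \<Xi> \<omega>), \<zeta> \<omega>)" "\<Phi> ((N \<omega>, \<Xi> \<omega>), \<zeta> \<omega>) \<le> 1" if "\<omega> \<in> space M" for \<omega>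
    using v01[OF \<Xi>_space[OF that]] by (auto simp: \<Phi>_def intro!: prod_nonneg prod_le_1)
  have G01: "0 \<le> (\<Prod>i<N \<omega>. g (\<Xi> \<omega> i))" "(\<Prod>i<N \<omega>. g (\<Xi> \<omega> i)) \<le> 1" if "\<omega> \<in> space M" for \<omega>
    using g01[OF \<Xi>_space[OF that]] by (auto intro!: prod_nonneg prod_le_1)
  have nn: "(\<integral>\<^sup>+ \<omega>. ennreal (\<Phi> ((N \<omega>, \<Xi> \<omega>), \<zeta> \<omega>)) \<partial>M) = (\<integral>\<^sup>+ \<omega>. ennreal (\<Prod>i<N \<omega>. g (\<Xi> \<omega> i)) \<partial>M)"
  proof -
    let ?C = "distr M (CS X) (\<lambda>\<omega>. (N \<omega>, \<Xi> \<omega>))"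
    have \<Phi>': "(\<lambda>y. ennreal (\<Phi> y)) \<in> borel_measurable (CS X \<Otimes>\<^sub>M SS K)" using \<Phi>_meas by simp
    have \<Phi>'': "(\<lambda>y. ennreal (\<Phi> y)) \<in> borel_measurable (?C \<Otimes>\<^sub>M SS K)"
      using \<Phi>' by (simp add: measurable_cong_sets[OF sets_pair_measure_cong[OF sets_distr refl] refl])
    have "(\<integral>\<^sup>+ \<omega>. ennreal (\<Phi> ((N \<omega>, \<Xi> \<omega>), \<zeta> \<omega>)) \<partial>M) =
        (\<integral>\<^sup>+ y. ennreal (\<Phi> y) \<partial>distr M (CS X \<Otimes>\<^sub>M SS K) (\<lambda>\<omega>. ((N \<omega>, \<Xi> \<omega>), \<zeta> \<omega>)))"
      using \<Phi>' by (intro nn_integral_distr[symmetric] joint) simp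
    also have "\<dots> = (\<integral>\<^sup>+ y. ennreal (\<Phi> y) \<partial>(?C \<Otimes>\<^sub>M SS K))" by (simp only: indep \<zeta>(2))
    also have "\<dots> = (\<integral>\<^sup>+ c. \<integral>\<^sup>+ z. ennreal (\<Phi> (c, z)) \<partial>SS K \<partial>?C)"
      by (rule SS.nn_integral_fst[OF \<Phi>'', symmetric])
    also have "\<dots> = (\<integral>\<^sup>+ \<omega>. \<integral>\<^sup>+ z. ennreal (\<Phi> ((N \<omega>, \<Xi> \<omega>), z)) \<partial>SS K \<partial>M)"
      using SS.borel_measurable_nn_integral_fst[OF \<Phi>'] by (intro nn_integral_distr cand) simp
    also have "\<dots> = (\<integral>\<^sup>+ \<omega>. ennreal (\<Prod>i<N \<omega>. g (\<Xi> \<omega> i)) \<partial>M)"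
      using measurable_space[OF cand] by (intro nn_integral_cong) (simp add: \<Phi>_inner)
    finally show ?thesis .
  qed
  \<comment> \<open>Measurability of the right-hand product is inherited from the inner integral, being its value at the candidates.\<close>
  have "(\<lambda>\<omega>. enn2real (\<integral>\<^sup>+ z. ennreal (\<Phi> ((N \<omega>, \<Xi> \<omega>), z)) \<partial>SS K)) \<in> borel_measurable M"
    using measurable_compose[OF cand SS.borel_measurable_nn_integral_fst[OF measurable_compose[OF \<Phi>_meas measurable_ennreal]]]
    by simp
  then have G_meas: "(\<lambda>\<omega>. \<Prod>i<N \<omega>. g (\<Xi> \<omega> i)) \<in> borel_measurable M"
    by (rule measurable_cong[THEN iffD1, rotated]) (use measurable_space[OF cand] \<Phi>_inner G01 in simp)
  have "ennreal (\<integral>\<omega>. \<Phi> ((N \<omega>, \<Xi> \<omega>), \<zeta> \<omega>) \<partial>M) = ennreal (\<integral>\<omega>. (\<Prod>i<N \<omega>. g (\<Xi> \<omega> i)) \<partial>M)"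
    using nn measurable_compose[OF joint \<Phi>_meas] G_meas \<Phi>01 G01
    by (subst (1 2) nn_integral_eq_integral[symmetric]) (auto intro!: integrable_const_bound[where B = 1])
  then have "(\<integral>\<omega>. \<Phi> ((N \<omega>, \<Xi> \<omega>), \<zeta> \<omega>) \<partial>M) = (\<integral>\<omega>. (\<Prod>i<N \<omega>. g (\<Xi> \<omega> i)) \<partial>M)"
    using \<Phi>01 G01 by (subst (asm) ennreal_inj) (auto intro!: Bochner_Integration.integral_nonneg)
  then show ?thesis by (simp only: left g_def)
qed

section \<open>The retained process\<close>

theorem corollary4p4:
  fixes b qmax lam \<gamma> :: real
    and w :: "nat \<Rightarrow> real"
    and \<phi> :: "nat \<Rightarrow> torus \<Rightarrow> real"
    and P :: "'p measure" and W :: "real \<Rightarrow> 'p \<Rightarrow> real \<times> real"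
    and H :: "'h measure" and \<tau> :: "nat \<Rightarrow> 'h \<Rightarrow> real"
    and J :: nat and s :: "nat \<Rightarrow> torus" and y \<sigma> a :: "nat \<Rightarrow> real" and n :: "nat \<Rightarrow> nat"
    and \<rho> :: "nat \<Rightarrow> real measure" and \<pi>0 :: "(nat \<Rightarrow> real) measure"
    and FS \<mu>0 \<nu> \<mu>y :: "(torus \<Rightarrow> real) measure"
    and Q :: "(nat \<Rightarrow> real) \<Rightarrow> torus \<Rightarrow> real" and L :: "(torus \<Rightarrow> real) \<Rightarrow> real" and Z :: real
    and M :: "'w measure" and N :: "'w \<Rightarrow> nat" and \<Xi> :: "'w \<Rightarrow> nat \<Rightarrow> nat \<Rightarrow> real"
    and \<zeta> :: "'w \<Rightarrow> nat \<Rightarrow> nat \<Rightarrow> ('h, 'p) forward_seed component_seed"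
    and SS :: "(nat \<Rightarrow> nat \<Rightarrow> ('h, 'p) forward_seed component_seed) measure"
    and CS :: "(nat \<times> (nat \<Rightarrow> nat \<Rightarrow> real)) measure"
    and \<eta> :: "'w \<Rightarrow> (torus \<Rightarrow> real) measure"
  assumes \<phi>: "\<And>l. \<phi> l \<in> borel_measurable torus_borel" "\<And>l x. \<bar>\<phi> l x\<bar> \<le> 1"
    and w: "summable (\<lambda>l. \<bar>w l\<bar>)" "(\<Sum>l. \<bar>w l\<bar>) < min b (1 - b)"
    and qmax: "qmax > 0" and lam: "lam > 0" and \<gamma>: "\<gamma> > 0"
    and Q: "Q = reaction_field qmax b w \<phi>"
    and W: "planar_brownian_motion P W"
    and \<tau>: "homogeneous_poisson_process H qmax \<tau>"
    and y: "\<And>j. j < J \<Longrightarrow> y j \<in> {0..1}"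
    and \<sigma>: "\<And>j. j < J \<Longrightarrow> \<sigma> j > 0"
    and a: "\<And>j. a j = 1 / (2 * (\<sigma> j)\<^sup>2)"
    and n: "\<And>j. j < J \<Longrightarrow> n j \<ge> 2"
    and L: "L = likelihood lam P W J s a y"
    and \<rho>: "\<And>l. prob_space (\<rho> l)" "\<And>l. sets (\<rho> l) = sets (restrict_space borel {-1..1})"
    and \<pi>0: "\<pi>0 = (\<Pi>\<^sub>M l\<in>UNIV. \<rho> l)"
    and FS: "Q \<in> measurable coefficient_space FS" "L \<in> borel_measurable FS"
    and \<mu>0: "\<mu>0 = distr \<pi>0 FS Q"
    and M: "prob_space M"
    and candidates: "N \<in> measurable M (count_space UNIV)"
      "\<And>i. (\<lambda>\<omega>. \<Xi> \<omega> i) \<in> measurable M coefficient_space"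
    and master: "poisson_point_process M (scale_measure (ennreal (\<gamma> * exp (total_shift J a n y))) \<mu>0)
      (\<lambda>\<omega>. point_configuration FS {..<N \<omega>} (\<lambda>i. Q (\<Xi> \<omega> i)))"
    and SS: "SS = (\<Pi>\<^sub>M i\<in>UNIV. candidate_seed_space (forward_seed_space lam H P) J a n y)"
    and CS: "CS = count_space UNIV \<Otimes>\<^sub>M (\<Pi>\<^sub>M i\<in>UNIV. coefficient_space)"
    and seeds: "\<zeta> \<in> measurable M SS" "distr M SS \<zeta> = SS"
    and indep: "distr M (CS \<Otimes>\<^sub>M SS) (\<lambda>\<omega>. ((N \<omega>, \<Xi> \<omega>), \<zeta> \<omega>)) =
      distr M CS (\<lambda>\<omega>. (N \<omega>, \<Xi> \<omega>)) \<Otimes>\<^sub>M distr M SS \<zeta>"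
    and \<eta>: "\<eta> = (\<lambda>\<omega>. point_configuration FS
      {i. i < N \<omega> \<and> retain_candidate (forward_coin b w \<phi> \<tau> W (\<Xi> \<omega> i)) J s n y (\<zeta> \<omega> i)}
      (\<lambda>i. Q (\<Xi> \<omega> i)))"
    and \<nu>: "\<nu> = density \<mu>0 (\<lambda>q. ennreal (L q))"
    and Z: "Z = (\<integral>q. L q \<partial>\<mu>0)"
    and \<mu>y: "\<mu>y = density \<mu>0 (\<lambda>q. ennreal (L q / Z))"
  shows "poisson_point_process M (scale_measure (ennreal \<gamma>) \<nu>) \<eta> \<and>
    (\<forall>k::nat.
      distr (uniform_measure M {\<omega>\<in>space M. emeasure (\<eta> \<omega>) (space FS) = of_nat k})
        (measure_algebra FS) \<eta> =
      distr (\<Pi>\<^sub>M i\<in>{..<k}. \<mu>y) (measure_algebra FS) (\<lambda>x. point_configuration FS {..<k} x))"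
proof -
  interpret FM: forward_model b w \<phi> lam qmax P W H \<tau>
    using \<phi> w lam qmax W \<tau> by unfold_locales auto
  interpret M: prob_space M by fact
  let ?X = coefficient_space and ?F = "forward_seed_space lam H P"
  let ?K = "candidate_seed_space ?F J a n y" and ?B = "total_shift J a n y"
  let ?ret = "\<lambda>\<xi>. retain_candidate (forward_coin b w \<phi> \<tau> W \<xi>) J s n y"
  let ?I = "\<lambda>\<omega>. {i. i < N \<omega> \<and> ?ret (\<Xi> \<omega> i) (\<zeta> \<omega> i)}"
  let ?x = "\<lambda>\<omega> i. Q (\<Xi> \<omega> i)"
  have a_pos: "0 < a j" if "j < J" for j using \<sigma>[OF that] by (simp add: a)
  have a_nonneg: "0 \<le> a j" for j by (simp add: a)
  have B_nonneg: "0 \<le> ?B"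
    unfolding total_shift_def using y n a_nonneg
    by (intro sum_nonneg mult_nonneg_nonneg bernstein_shift_nonneg) auto
  have L01: "0 < L q" "L q \<le> 1" for q
    unfolding L likelihood_def using a_nonneg by (auto intro!: sum_nonneg mult_nonneg_nonneg)
  have K: "prob_space ?K" by (rule prob_space_candidate_seed_space[OF FM.prob_space_F])
  have coin_meas: "Measurable.pred (?X \<Otimes>\<^sub>M ?F) (\<lambda>q. forward_coin b w \<phi> \<tau> W (fst q) x (snd q))" for x
    by (rule FM.measurable_coin)
  have ret_meas: "Measurable.pred (?X \<Otimes>\<^sub>M ?K) (\<lambda>q. ?ret (fst q) (snd q))"
    by (rule measurable_retain_candidate[OF coin_meas])
  have ret_prob: "measure ?K {z \<in> space ?K. ?ret \<xi> z} = L (Q \<xi>) * exp (- ?B)" if \<xi>: "\<xi> \<in> space ?X" for \<xi>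
  proof -
    have p: "measure ?F {z \<in> space ?F. forward_coin b w \<phi> \<tau> W \<xi> x z} = survival_prob lam P W x (Q \<xi>)" for x
      using FM.forward_coin_prob[OF \<xi>, of x] by (simp add: Q measure_def)
    have "Measurable.pred ?F (forward_coin b w \<phi> \<tau> W \<xi> x)" for x
      using measurable_compose[OF measurable_Pair1'[OF \<xi>] coin_meas] by simp
    then have "emeasure ?K {z \<in> space ?K. ?ret \<xi> z} = ennreal (L (Q \<xi>) * exp (- ?B))"
      using retain_candidate_prob[where coin = "forward_coin b w \<phi> \<tau> W \<xi>" and y = y and s = s,
          OF FM.prob_space_F _ n a_pos]
      by (simp add: p L likelihood_def)
    then show ?thesis using L01[of "Q \<xi>"] by (simp add: measure_def)
  qed
  have sets_\<pi>0: "sets \<pi>0 = sets ?X"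
    unfolding \<pi>0 coefficient_space_def by (intro sets_PiM_cong refl \<rho>)
  have prob_\<pi>0: "prob_space \<pi>0" unfolding \<pi>0 by (intro prob_space_PiM \<rho>)
  have Q_meas: "Q \<in> measurable \<pi>0 FS" using FS(1) by (simp add: measurable_cong_sets[OF sets_\<pi>0 refl])
  interpret \<mu>0: prob_space \<mu>0 unfolding \<mu>0 by (rule prob_space.prob_space_distr[OF prob_\<pi>0 Q_meas])
  have sets_\<mu>0[measurable_cong, simp]: "sets \<mu>0 = sets FS" by (simp add: \<mu>0)
  have space_\<mu>0: "space \<mu>0 = space FS" by (rule sets_eq_imp_space_eq) simp
  note [measurable] = FS(2)
  have L_int: "integrable \<mu>0 L"
    by (rule \<mu>0.integrable_const_bound[where B = 1]) (use L01 in \<open>auto intro!: AE_I2 simp: less_imp_le abs_of_pos\<close>)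
  have Z_pos: "0 < Z"
  proof -
    have "Z \<noteq> 0"
    proof
      assume "Z = 0"
      then have "AE q in \<mu>0. L q = 0"
        using integral_nonneg_eq_0_iff_AE[OF L_int] L01 by (simp add: Z less_imp_le)
      then have "AE q in \<mu>0. False" by eventually_elim (use L01 in \<open>simp add: less_imp_neq[symmetric]\<close>)
      then show False by simp
    qed
    moreover have "0 \<le> Z" unfolding Z using L01 by (intro Bochner_Integration.integral_nonneg) (simp add: less_imp_le)
    ultimately show ?thesis by simp
  qed
  have sets_\<mu>y: "sets \<mu>y = sets FS" by (simp add: \<mu>y)
  have prob_\<mu>y: "prob_space \<mu>y"
  proof
    have "emeasure \<mu>y (space \<mu>y) = (\<integral>\<^sup>+ q. ennreal (L q / Z) \<partial>\<mu>0)"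
      unfolding \<mu>y by (subst emeasure_density) (auto simp: space_\<mu>0 intro!: nn_integral_cong)
    also have "\<dots> = ennreal (\<integral>q. L q / Z \<partial>\<mu>0)"
      using L_int L01 Z_pos by (intro nn_integral_eq_integral) (auto simp: less_imp_le)
    finally show "emeasure \<mu>y (space \<mu>y) = 1" using Z_pos by (simp add: Z[symmetric])
  qed
  \<comment> \<open>The retained process has the finite intensity \<open>\<gamma> Z\<close> times the posterior, which turns both claims into statements about a probability measure.\<close>
  have intensity: "scale_measure (ennreal \<gamma>) \<nu> = scale_measure (ennreal (\<gamma> * Z)) \<mu>y"
    unfolding scale_measure_eq_density \<nu> \<mu>y using \<gamma> Z_pos L01
    by (simp add: density_density_eq ennreal_mult[symmetric] less_imp_le)
  have joint: "(\<lambda>\<omega>. (\<Xi> \<omega> i, \<zeta> \<omega> i)) \<in> measurable M (?X \<Otimes>\<^sub>M ?K)" for i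
    using candidates(2) seeds(1)
    by (intro measurable_Pair) (auto simp: SS intro: measurable_compose[OF _ measurable_component_singleton])
  have x_meas: "(\<lambda>\<omega>. ?x \<omega> i) \<in> measurable M FS" for i
    by (rule measurable_compose[OF candidates(2) FS(1)])
  interpret R: poisson_laplace M \<mu>y FS "\<gamma> * Z" ?I ?x
  proof (intro poisson_laplace.intro poisson_laplace_axioms.intro M.prob_space_axioms prob_\<mu>y sets_\<mu>y)
    show "0 < \<gamma> * Z" using \<gamma> Z_pos by simp
    show "finite (?I \<omega>)" for \<omega> by simp
    show "?x \<omega> i \<in> space FS" if "\<omega> \<in> space M" for \<omega> i using measurable_space[OF x_meas that] .
    show "(\<lambda>\<omega>. card {i \<in> ?I \<omega>. ?x \<omega> i \<in> A}) \<in> measurable M (count_space UNIV)" if A: "A \<in> sets FS" for A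
    proof (rule measurable_card)
      fix i
      have [measurable]: "Measurable.pred M (\<lambda>\<omega>. ?ret (\<Xi> \<omega> i) (\<zeta> \<omega> i))"
        using measurable_compose[OF joint ret_meas] by simp
      note [measurable] = x_meas[of i] candidates(1) A
      show "{\<omega> \<in> space M. i \<in> {i \<in> ?I \<omega>. ?x \<omega> i \<in> A}} \<in> sets M"
        unfolding mem_Collect_eq by measurable
    qed
    fix h :: "(torus \<Rightarrow> real) \<Rightarrow> real"
    assume h[measurable]: "h \<in> borel_measurable FS" and h01: "\<And>q. q \<in> space FS \<Longrightarrow> 0 \<le> h q \<and> h q \<le> 1"
    let ?g = "\<lambda>q. 1 - L q * exp (- ?B) * (1 - h q)"
    let ?\<Lambda> = "scale_measure (ennreal (\<gamma> * exp ?B)) \<mu>0"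
    have Q_space: "Q \<xi> \<in> space FS" if "\<xi> \<in> space ?X" for \<xi> using measurable_space[OF FS(1) that] .
    have "(\<integral>\<omega>. (\<Prod>i\<in>?I \<omega>. h (?x \<omega> i)) \<partial>M) = (\<integral>\<omega>. (\<Prod>i<N \<omega>. ?g (?x \<omega> i)) \<partial>M)"
      using seeds indep unfolding SS CS
      by (intro thinning_integral[OF M K candidates _ _ _ ret_meas ret_prob, where h = "\<lambda>\<xi>. h (Q \<xi>)"])
        (auto simp: h01 Q_space intro: measurable_compose[OF FS(1) h])
    also have "\<dots> = (\<integral>\<omega>. (\<Prod>i\<in>{i \<in> {..<N \<omega>}. ?x \<omega> i \<in> space FS}. ?g (?x \<omega> i)) \<partial>M)"
    proof (intro Bochner_Integration.integral_cong refl prod.cong)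
      fix \<omega> assume "\<omega> \<in> space M"
      then show "{..<N \<omega>} = {i \<in> {..<N \<omega>}. ?x \<omega> i \<in> space FS}" using measurable_space[OF x_meas] by auto
    qed
    also have "\<dots> = exp (- (LINT q:space FS|?\<Lambda>. 1 - ?g q))"
    proof (rule poisson_laplace_functional(2)[OF M master])
      show "emeasure ?\<Lambda> (space FS) < \<infinity>"
        using \<mu>0.emeasure_space_1 by (simp add: space_\<mu>0)
      show "0 \<le> ?g q \<and> ?g q \<le> 1" if "q \<in> space FS" for q
      proof -
        have "L q * exp (- ?B) * (1 - h q) \<le> 1 * 1 * 1"
          using L01[of q] B_nonneg h01[OF that] by (intro mult_mono) (auto simp: less_imp_le)
        moreover have "0 \<le> L q * exp (- ?B) * (1 - h q)"
          using L01[of q] h01[OF that] by (auto simp: less_imp_le)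
        ultimately show ?thesis by simp
      qed
    qed (use measurable_space[OF x_meas] in auto)
    \<comment> \<open>The factor \<open>exp B\<close> of the master intensity cancels the factor \<open>exp (- B)\<close> of the retention probability.\<close>
    also have "(LINT q:space FS|?\<Lambda>. 1 - ?g q) = (\<integral>q. \<gamma> * (L q * (1 - h q)) \<partial>\<mu>0)"
    proof -
      have "(LINT q:space FS|?\<Lambda>. 1 - ?g q) = (\<integral>q. (\<gamma> * exp ?B) *\<^sub>R (indicator (space FS) q *\<^sub>R (1 - ?g q)) \<partial>\<mu>0)"
        unfolding set_lebesgue_integral_def scale_measure_eq_density using \<gamma>
        by (intro integral_density) auto
      also have "\<dots> = (\<integral>q. \<gamma> * (L q * (1 - h q)) \<partial>\<mu>0)"
        by (intro Bochner_Integration.integral_cong refl) (simp add: space_\<mu>0 exp_minus field_simps)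
      finally show ?thesis .
    qed
    also have "\<dots> = \<gamma> * Z * (\<integral>q. 1 - h q \<partial>\<mu>y)"
    proof -
      have "(\<integral>q. 1 - h q \<partial>\<mu>y) = (\<integral>q. (L q / Z) *\<^sub>R (1 - h q) \<partial>\<mu>0)"
        unfolding \<mu>y using L01 Z_pos by (intro integral_density) (auto simp: less_imp_le)
      also have "\<dots> = (\<integral>q. L q * (1 - h q) \<partial>\<mu>0) / Z" by simp
      finally show ?thesis using Z_pos by simp
    qed
    finally show "(\<integral>\<omega>. (\<Prod>i\<in>?I \<omega>. h (?x \<omega> i)) \<partial>M) = exp (- (\<gamma> * Z * (\<integral>q. 1 - h q \<partial>\<mu>y)))" .
  qed
  show ?thesis
    unfolding \<eta> intensity using R.poisson_point_process_\<eta> R.conditional_law_\<eta> by blast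
qed

end
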